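(* Let $T$ be a linear operator on $\mathcal{A}=L^2(\mathbb{R}^d)\cap L^\infty(\mathbb{R}^d)$. Then $\Gamma_2(T)$ is an isometry (resp. unitary) if and only if there exist a function $\alpha:\mathbb{R}^d\to\mathbb{R}$ and a $*$-endomorphism (resp. $*$-automorphism) $T_1$ of $\mathcal{A}$ such that $$T=e^{i\alpha}T_1,$$ i.e. $Tf=e^{i\alpha}\cdot T_1f$ for all $f\in\mathcal{A}$.
   Context: Fix $d\ge1$ and a constant $c>0$. $\mathcal{A}=L^2(\mathbb{R}^d)\cap L^\infty(\mathbb{R}^d)$ denotes the complex-valued functions (modulo a.e. equality) with pointwise multiplication, complex conjugation, and $\langle f,g\rangle=\int_{\mathbb{R}^d}\bar f(s)g(s)\,ds$. The RSWN algebra is the $*$-Lie algebra with central element $1$ and generators $B^+_f,B_f,N_f$ ($f\in\mathcal{A}$), with $f\mapsto B_f^+$ and $f\mapsto N_f$ complex linear, involution $(B_f^+)^*=B_f$, $N_f^*=N_{\bar f}$, and commutation relations $[B_f,B^+_g]=2c\langle f,g\rangle 1+4N_{\bar f g}$, $[N_a,B_f^+]=2B^+_{af}$, $[B^+_f,B^+_g]=[B_f,B_g]=[N_a,N_{a'}]=0$. On its universal enveloping algebra there is a unique state $\varphi_F$ with $\varphi_F(1)=1$ and $\varphi_F(xB_g)=\varphi_F(xN_f)=0$ for all $f,g\in\mathcal{A}$ and all $x$ (a known fact). The quadratic Fock space $\Gamma_2(\mathcal{A})$ is the (complete) GNS Hilbert space of $\varphi_F$, with cyclic unit vector $\Phi$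 satisfying $B_f\Phi=N_f\Phi=0$ for all $f\in\mathcal{A}$. For $f\in\mathcal{A}$ the quadratic exponential vector is $\Psi(f)=\sum_{n\ge0}\frac{1}{n!}B^{+n}_f\Phi$ when the series converges. Known facts: $\Psi(f)$ exists if $\|f\|_\infty<\frac12$ and does not exist if $\|f\|_\infty>\frac12$; the set of these vectors is linearly independent and total in $\Gamma_2(\mathcal{A})$; and $\langle\Psi(f),\Psi(g)\rangle=\exp\big(-\frac c2\int_{\mathbb{R}^d}\ln(1-4\bar f(s)g(s))\,ds\big)$ for $\|f\|_\infty,\|g\|_\infty<\frac12$. For a linear operator $T$ on $\mathcal{A}$, if $\Psi(f)\mapsto\Psi(Tf)$ is well defined on all quadratic exponential vectors with $\|f\|_\infty<\frac12$, its linear extension to their (dense) linear span is denoted $\Gamma_2(T)$, the quadratic second quantization of $T$. Saying that $\Gamma_2(T)$ is an isometry (resp. unitary) means that it is well defined and extends to an isometry (resp. a unitary operator) of $\Gamma_2(\mathcal{A})$. A $*$-endomorphism (resp. $*$-automorphism) of $\mathcal{A}$ is a linear map $T_1:\mathcal{A}\to\mathcal{A}$ which is an isometry (resp. a unitary operator, i.e. a surjective isometry) for the pre-Hilbert structure $\langle\cdot,\cdot\rangle$ of $\mathcal{A}$ and satisfies $T_1(fg)=T_1(f)T_1(g)$ and $\overline{T_1(f)}=T_1(\bar f)$ for all $f,g\in\mathcal{A}$. *)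

theory Defs
  imports
    "HOL-Probability.Essential_Supremum"
    "HOL-Library.Poly_Mapping"
    "HOL-Library.Nonpos_Ints"
begin

section \<open>Complex vector spaces and complex Hilbert spaces\<close>

class scaleC =
  fixes scaleC :: "complex \<Rightarrow> 'a \<Rightarrow> 'a"  (infixr \<open>*\<^sub>C\<close> 75)

class complex_vector = scaleC + ab_group_add +
  assumes scaleC_add_right: "a *\<^sub>C (x + y) = a *\<^sub>C x + a *\<^sub>C y"
    and scaleC_add_left: "(a + b) *\<^sub>C x = a *\<^sub>C x + b *\<^sub>C x"
    and scaleC_scaleC: "a *\<^sub>C b *\<^sub>C x = (a * b) *\<^sub>C x"
    and scaleC_one: "1 *\<^sub>C x = x"

text \<open>Completeness and the topology come from \<^class>\<open>banach\<close>; the last two axioms tie the real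
  normed structure to the complex inner product, which is linear in its second argument.\<close>

class complex_hilbert = complex_vector + banach +
  fixes cinner :: "'a \<Rightarrow> 'a \<Rightarrow> complex"
  assumes cinner_commute: "cinner x y = cnj (cinner y x)"
    and cinner_add_right: "cinner x (y + z) = cinner x y + cinner x z"
    and cinner_scaleC_right: "cinner x (a *\<^sub>C y) = a * cinner x y"
    and cinner_self_norm: "cinner x x = complex_of_real ((norm x)\<^sup>2)"
    and scaleC_of_real: "complex_of_real r *\<^sub>C x = r *\<^sub>R x"

abbreviation clinear :: "('a::complex_vector \<Rightarrow> 'b::complex_vector) \<Rightarrow> bool" where
  "clinear \<equiv> Vector_Spaces.linear scaleC scaleC"

definition hilbert_isometry :: "('h::complex_hilbert \<Rightarrow> 'h) \<Rightarrow> bool" where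
  "hilbert_isometry V \<longleftrightarrow> clinear V \<and> (\<forall>x y. cinner (V x) (V y) = cinner x y)"

definition hilbert_unitary :: "('h::complex_hilbert \<Rightarrow> 'h) \<Rightarrow> bool" where
  "hilbert_unitary V \<longleftrightarrow> hilbert_isometry V \<and> surj V"

section \<open>The algebra $L^2 \cap L^\infty$\<close>

text \<open>Every class of Lebesgue measurable functions modulo a.e. equality has a Borel representative,
  so Borel functions and \<^const>\<open>lborel\<close> give the usual spaces.\<close>

definition L2Linf_fun :: "(real ^ 'd::finite \<Rightarrow> complex) set" where
  "L2Linf_fun = {f. f \<in> borel_measurable lborel \<and>
     integrable lborel (\<lambda>s. (norm (f s))\<^sup>2) \<and> esssup lborel (\<lambda>s. ereal (norm (f s))) < \<infinity>}"

definition L2Linf_rel :: "(real ^ 'd::finite \<Rightarrow> complex) \<Rightarrow> (real ^ 'd \<Rightarrow> complex) \<Rightarrow> bool" where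
  "L2Linf_rel f g \<longleftrightarrow> f \<in> L2Linf_fun \<and> g \<in> L2Linf_fun \<and> (AE s in lborel. f s = g s)"

lemma L2Linf_fun_iff:
  "f \<in> L2Linf_fun \<longleftrightarrow> f \<in> borel_measurable lborel \<and>
     integrable lborel (\<lambda>s. (norm (f s))\<^sup>2) \<and> (\<exists>C. AE s in lborel. norm (f s) \<le> C)"
proof (cases "f \<in> borel_measurable lborel")
  case True
  note [measurable] = True
  have "esssup lborel (\<lambda>s. ereal (norm (f s))) < \<infinity> \<longleftrightarrow> (\<exists>C. AE s in lborel. norm (f s) \<le> C)"
  proof
    assume "esssup lborel (\<lambda>s. ereal (norm (f s))) < \<infinity>"
    then obtain C where C: "esssup lborel (\<lambda>s. ereal (norm (f s))) < ereal C"
      using ereal_dense2 by blast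
    have "AE s in lborel. norm (f s) \<le> C"
      using esssup_AE[of "\<lambda>s. ereal (norm (f s))" lborel]
    proof eventually_elim
      case (elim s)
      from le_less_trans[OF elim C] show ?case by simp
    qed
    then show "\<exists>C. AE s in lborel. norm (f s) \<le> C" by blast
  next
    assume "\<exists>C. AE s in lborel. norm (f s) \<le> C"
    then obtain C where "AE s in lborel. norm (f s) \<le> C" by blast
    then have "AE s in lborel. ereal (norm (f s)) \<le> ereal C" by simp
    then have "esssup lborel (\<lambda>s. ereal (norm (f s))) \<le> ereal C"
      by (intro esssup_I) measurable
    also have "ereal C < \<infinity>" by simp
    finally show "esssup lborel (\<lambda>s. ereal (norm (f s))) < \<infinity>" .
  qed
  then show ?thesis by (auto simp: L2Linf_fun_def)
qed (auto simp: L2Linf_fun_def)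

lemma L2Linf_fun_zero: "(\<lambda>_. 0) \<in> L2Linf_fun"
  by (auto simp: L2Linf_fun_iff)

lemma measurable_cnj [measurable]: "cnj \<in> borel_measurable borel"
  by (intro borel_measurable_continuous_onI continuous_intros)

lemma L2Linf_fun_cnj:
  assumes "f \<in> L2Linf_fun"
  shows "(\<lambda>s. cnj (f s)) \<in> L2Linf_fun"
proof -
  from assms have [measurable]: "f \<in> borel_measurable lborel"
    by (simp add: L2Linf_fun_iff)
  have "(\<lambda>s. cnj (f s)) \<in> borel_measurable lborel" by measurable
  then show ?thesis using assms by (simp add: L2Linf_fun_iff)
qed

lemma L2Linf_fun_scale:
  assumes "f \<in> L2Linf_fun"
  shows "(\<lambda>s. a * f s) \<in> L2Linf_fun"
proof -
  from assms have [measurable]: "f \<in> borel_measurable lborel"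
    and i: "integrable lborel (\<lambda>s. (norm (f s))\<^sup>2)"
    by (auto simp: L2Linf_fun_iff)
  from assms obtain C where "AE s in lborel. norm (f s) \<le> C"
    by (auto simp: L2Linf_fun_iff)
  then have "AE s in lborel. norm (a * f s) \<le> norm a * C"
    by eventually_elim (auto simp: norm_mult intro: mult_left_mono)
  moreover have "integrable lborel (\<lambda>s. (norm (a * f s))\<^sup>2)"
    using i by (simp add: norm_mult power_mult_distrib)
  ultimately show ?thesis by (auto simp: L2Linf_fun_iff)
qed

lemma L2Linf_fun_add:
  assumes "f \<in> L2Linf_fun" "g \<in> L2Linf_fun"
  shows "(\<lambda>s. f s + g s) \<in> L2Linf_fun"
proof -
  from assms have [measurable]: "f \<in> borel_measurable lborel" "g \<in> borel_measurable lborel"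
    and i: "integrable lborel (\<lambda>s. (norm (f s))\<^sup>2)" "integrable lborel (\<lambda>s. (norm (g s))\<^sup>2)"
    by (auto simp: L2Linf_fun_iff)
  from assms obtain C D where "AE s in lborel. norm (f s) \<le> C" "AE s in lborel. norm (g s) \<le> D"
    by (auto simp: L2Linf_fun_iff)
  then have "AE s in lborel. norm (f s + g s) \<le> C + D"
    by eventually_elim (meson add_mono norm_triangle_le order_trans)
  moreover have "integrable lborel (\<lambda>s. (norm (f s + g s))\<^sup>2)"
  proof (rule Bochner_Integration.integrable_bound)
    show "integrable lborel (\<lambda>s. 2 * (norm (f s))\<^sup>2 + 2 * (norm (g s))\<^sup>2)"
      using i by simp
    have "(norm (f s + g s))\<^sup>2 \<le> 2 * (norm (f s))\<^sup>2 + 2 * (norm (g s))\<^sup>2" for s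
    proof -
      have "(norm (f s + g s))\<^sup>2 \<le> (norm (f s) + norm (g s))\<^sup>2"
        by (intro power_mono norm_triangle_ineq) auto
      also have "\<dots> \<le> 2 * (norm (f s))\<^sup>2 + 2 * (norm (g s))\<^sup>2"
        using sum_squares_bound[of "norm (f s)" "norm (g s)"] by (simp add: power2_sum)
      finally show ?thesis .
    qed
    then show "AE s in lborel. norm ((norm (f s + g s))\<^sup>2)
        \<le> norm (2 * (norm (f s))\<^sup>2 + 2 * (norm (g s))\<^sup>2)"
      by (intro AE_I2) simp
  qed simp
  ultimately show ?thesis by (auto simp: L2Linf_fun_iff)
qed

lemma L2Linf_fun_mult:
  assumes "f \<in> L2Linf_fun" "g \<in> L2Linf_fun"
  shows "(\<lambda>s. f s * g s) \<in> L2Linf_fun"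
proof -
  from assms have [measurable]: "f \<in> borel_measurable lborel" "g \<in> borel_measurable lborel"
    and i: "integrable lborel (\<lambda>s. (norm (g s))\<^sup>2)"
    by (auto simp: L2Linf_fun_iff)
  from assms obtain C D where C: "AE s in lborel. norm (f s) \<le> C"
    and D: "AE s in lborel. norm (g s) \<le> D"
    by (auto simp: L2Linf_fun_iff)
  have "AE s in lborel. norm (f s * g s) \<le> C * D"
    using C D by eventually_elim
      (metis mult_mono' norm_ge_zero norm_mult)
  moreover have "integrable lborel (\<lambda>s. (norm (f s * g s))\<^sup>2)"
  proof (rule Bochner_Integration.integrable_bound)
    show "integrable lborel (\<lambda>s. C\<^sup>2 * (norm (g s))\<^sup>2)"
      using i by simp
    show "AE s in lborel. norm ((norm (f s * g s))\<^sup>2) \<le> norm (C\<^sup>2 * (norm (g s))\<^sup>2)"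
      using C by eventually_elim
        (auto simp: norm_mult power_mult_distrib intro!: mult_right_mono power_mono)
  qed simp
  ultimately show ?thesis by (auto simp: L2Linf_fun_iff)
qed

lemma L2Linf_rel_part_equivp: "part_equivp (L2Linf_rel :: (real ^ 'd::finite \<Rightarrow> complex) \<Rightarrow> _)"
proof (rule part_equivpI)
  show "\<exists>f :: real ^ 'd \<Rightarrow> complex. L2Linf_rel f f"
    using L2Linf_fun_zero by (auto simp: L2Linf_rel_def)
  show "symp (L2Linf_rel :: (real ^ 'd \<Rightarrow> complex) \<Rightarrow> _)"
    by (rule sympI) (auto simp: L2Linf_rel_def elim!: eventually_mono)
  show "transp (L2Linf_rel :: (real ^ 'd \<Rightarrow> complex) \<Rightarrow> _)"
  proof (rule transpI)
    fix f g h :: "real ^ 'd \<Rightarrow> complex"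
    assume a: "L2Linf_rel f g" "L2Linf_rel g h"
    then have "AE s in lborel. f s = g s" "AE s in lborel. g s = h s"
      by (simp_all add: L2Linf_rel_def)
    then have "AE s in lborel. f s = h s"
      by eventually_elim simp
    with a show "L2Linf_rel f h"
      by (simp add: L2Linf_rel_def)
  qed
qed

quotient_type (overloaded) 'd L2Linf = "real ^ 'd::finite \<Rightarrow> complex" / partial: L2Linf_rel
  by (rule L2Linf_rel_part_equivp)

instantiation L2Linf :: (finite) "{comm_ring, complex_vector}"
begin

lift_definition zero_L2Linf :: "'a L2Linf" is "\<lambda>_. 0"
  by (simp add: L2Linf_rel_def L2Linf_fun_zero)

lift_definition plus_L2Linf :: "'a L2Linf \<Rightarrow> 'a L2Linf \<Rightarrow> 'a L2Linf" is "\<lambda>f g s. f s + g s"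
  by (auto simp: L2Linf_rel_def L2Linf_fun_add)

lift_definition scaleC_L2Linf :: "complex \<Rightarrow> 'a L2Linf \<Rightarrow> 'a L2Linf" is "\<lambda>a f s. a * f s"
  by (auto simp: L2Linf_rel_def L2Linf_fun_scale)

lift_definition times_L2Linf :: "'a L2Linf \<Rightarrow> 'a L2Linf \<Rightarrow> 'a L2Linf" is "\<lambda>f g s. f s * g s"
  by (auto simp: L2Linf_rel_def L2Linf_fun_mult)

definition uminus_L2Linf :: "'a L2Linf \<Rightarrow> 'a L2Linf" where
  "uminus_L2Linf f = (-1) *\<^sub>C f"

definition minus_L2Linf :: "'a L2Linf \<Rightarrow> 'a L2Linf \<Rightarrow> 'a L2Linf" where
  "minus_L2Linf f g = f + (-1) *\<^sub>C g"

instance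
proof
  fix f g h :: "'a L2Linf" and a b :: complex
  note closed = L2Linf_rel_def L2Linf_fun_add L2Linf_fun_mult L2Linf_fun_scale L2Linf_fun_zero
  show "f + g + h = f + (g + h)" by transfer (auto simp: closed add.assoc)
  show "f + g = g + f" by transfer (auto simp: closed add.commute)
  show "0 + f = f" by transfer (auto simp: closed)
  show "- f + f = 0" unfolding uminus_L2Linf_def by transfer (auto simp: closed)
  show "f - g = f + - g" unfolding uminus_L2Linf_def minus_L2Linf_def ..
  show "f * g * h = f * (g * h)" by transfer (auto simp: closed mult.assoc)
  show "f * g = g * f" by transfer (auto simp: closed mult.commute)
  show "(f + g) * h = f * h + g * h" by transfer (auto simp: closed distrib_right)
  show "a *\<^sub>C (f + g) = a *\<^sub>C f + a *\<^sub>C g" by transfer (auto simp: closed distrib_left)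
  show "(a + b) *\<^sub>C f = a *\<^sub>C f + b *\<^sub>C f" by transfer (auto simp: closed distrib_right)
  show "a *\<^sub>C b *\<^sub>C f = (a * b) *\<^sub>C f" by transfer (auto simp: closed mult.assoc)
  show "1 *\<^sub>C f = f" by transfer (auto simp: closed)
qed

end

lift_definition conj_fun :: "'d::finite L2Linf \<Rightarrow> 'd L2Linf" is "\<lambda>f s. cnj (f s)"
  by (auto simp: L2Linf_rel_def L2Linf_fun_cnj)

lift_definition inner_fun :: "'d::finite L2Linf \<Rightarrow> 'd L2Linf \<Rightarrow> complex"
  is "\<lambda>f g. \<integral>s. cnj (f s) * g s \<partial>lborel"
proof -
  fix f f' g g' :: "real ^ 'd \<Rightarrow> complex"
  assume a: "L2Linf_rel f f'" "L2Linf_rel g g'"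
  then have [measurable]: "f \<in> borel_measurable lborel" "f' \<in> borel_measurable lborel"
      "g \<in> borel_measurable lborel" "g' \<in> borel_measurable lborel"
    by (auto simp: L2Linf_rel_def L2Linf_fun_def)
  show "(\<integral>s. cnj (f s) * g s \<partial>lborel) = (\<integral>s. cnj (f' s) * g' s \<partial>lborel)"
    by (rule integral_cong_AE) (use a in \<open>auto simp: L2Linf_rel_def\<close>)
qed

lift_definition linf_norm :: "'d::finite L2Linf \<Rightarrow> ereal"
  is "\<lambda>f. esssup lborel (\<lambda>s. ereal (norm (f s)))"
proof -
  fix f f' :: "real ^ 'd \<Rightarrow> complex"
  assume a: "L2Linf_rel f f'"
  then have [measurable]: "f \<in> borel_measurable lborel" "f' \<in> borel_measurable lborel"
    by (auto simp: L2Linf_rel_def L2Linf_fun_def)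
  show "esssup lborel (\<lambda>s. ereal (norm (f s))) = esssup lborel (\<lambda>s. ereal (norm (f' s)))"
    by (rule esssup_AE_cong) (use a in \<open>auto simp: L2Linf_rel_def\<close>)
qed

text \<open>\<open>is_phase_mult \<alpha> f g\<close> means $g = e^{i\alpha} f$.\<close>

lift_definition is_phase_mult :: "(real ^ 'd \<Rightarrow> real) \<Rightarrow> 'd::finite L2Linf \<Rightarrow> 'd L2Linf \<Rightarrow> bool"
  is "\<lambda>\<alpha> f g. AE s in lborel. g s = exp (\<i> * complex_of_real (\<alpha> s)) * f s"
proof -
  fix \<alpha> :: "real ^ 'd \<Rightarrow> real" and f f' g g' :: "real ^ 'd \<Rightarrow> complex"
  assume "L2Linf_rel f f'" "L2Linf_rel g g'"
  then have "AE s in lborel. f s = f' s \<and> g s = g' s"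
    by (auto simp: L2Linf_rel_def)
  then have "AE s in lborel. (g s = exp (\<i> * complex_of_real (\<alpha> s)) * f s) =
      (g' s = exp (\<i> * complex_of_real (\<alpha> s)) * f' s)"
    by eventually_elim simp
  then show "(AE s in lborel. g s = exp (\<i> * complex_of_real (\<alpha> s)) * f s) =
      (AE s in lborel. g' s = exp (\<i> * complex_of_real (\<alpha> s)) * f' s)"
    by (rule eventually_subst)
qed

definition star_endomorphism :: "('d::finite L2Linf \<Rightarrow> 'd L2Linf) \<Rightarrow> bool" where
  "star_endomorphism T \<longleftrightarrow> clinear T \<and>
     (\<forall>f g. inner_fun (T f) (T g) = inner_fun f g) \<and>
     (\<forall>f g. T (f * g) = T f * T g) \<and>
     (\<forall>f. conj_fun (T f) = T (conj_fun f))"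

definition star_automorphism :: "('d::finite L2Linf \<Rightarrow> 'd L2Linf) \<Rightarrow> bool" where
  "star_automorphism T \<longleftrightarrow> star_endomorphism T \<and> surj T"

section \<open>The renormalized square of white noise\<close>

text \<open>Free unital associative algebra on the symbols $B^+_f, B_f, N_f$: finitely supported complex
  functions on words, with convolution as product.\<close>

datatype 'a rswn_gen = Bplus 'a | Bminus 'a | Num 'a

datatype 'g free_word = Word (letters: "'g list")

instantiation free_word :: (type) monoid_add
begin

definition zero_free_word :: "'a free_word" where
  "zero_free_word = Word []"

definition plus_free_word :: "'a free_word \<Rightarrow> 'a free_word \<Rightarrow> 'a free_word" where
  "plus_free_word v w = Word (letters v @ letters w)"

instance
  by standard (auto simp: zero_free_word_def plus_free_word_def)

end

type_synonym 'd rswn_free = "'d L2Linf rswn_gen free_word \<Rightarrow>\<^sub>0 complex"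

definition scalar :: "complex \<Rightarrow> 'd::finite rswn_free" where
  "scalar z = Poly_Mapping.single 0 z"

abbreviation free_scale :: "complex \<Rightarrow> 'd::finite rswn_free \<Rightarrow> 'd rswn_free" where
  "free_scale z x \<equiv> scalar z * x"

definition gen :: "'d L2Linf rswn_gen \<Rightarrow> 'd::finite rswn_free" where
  "gen a = Poly_Mapping.single (Word [a]) 1"

fun star_gen :: "'d::finite L2Linf rswn_gen \<Rightarrow> 'd L2Linf rswn_gen" where
  "star_gen (Bplus f) = Bminus f"
| "star_gen (Bminus f) = Bplus f"
| "star_gen (Num f) = Num (conj_fun f)"

definition star_word :: "'d::finite L2Linf rswn_gen free_word \<Rightarrow> 'd L2Linf rswn_gen free_word" where
  "star_word w = Word (rev (map star_gen (letters w)))"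

definition star :: "'d::finite rswn_free \<Rightarrow> 'd rswn_free" where
  "star x = (\<Sum>w\<in>Poly_Mapping.keys x.
     Poly_Mapping.single (star_word w) (cnj (Poly_Mapping.lookup x w)))"

definition commutator :: "'a::ring \<Rightarrow> 'a \<Rightarrow> 'a" where
  "commutator x y = x * y - y * x"

text \<open>The universal enveloping algebra of the RSWN algebra with constant \<open>c\<close> is the quotient of the
  free algebra by the following two-sided $*$-ideal (the central element being the unit).
  Closure under \<^const>\<open>star\<close> yields the adjoint relations, namely that $f \mapsto B_f$ is
  antilinear and $[N_a, B_f] = -2 B_{\bar a f}$. The quotient depends on \<open>c\<close>, so it is not formed as
  a type: linear functionals on it are linear functionals on the free algebra vanishing on the ideal.\<close>

inductive_set rswn_ideal :: "real \<Rightarrow> 'd::finite rswn_free set" for c :: real where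
  Bplus_add: "gen (Bplus (f + g)) - (gen (Bplus f) + gen (Bplus g)) \<in> rswn_ideal c"
| Bplus_scale: "gen (Bplus (z *\<^sub>C f)) - free_scale z (gen (Bplus f)) \<in> rswn_ideal c"
| Num_add: "gen (Num (f + g)) - (gen (Num f) + gen (Num g)) \<in> rswn_ideal c"
| Num_scale: "gen (Num (z *\<^sub>C f)) - free_scale z (gen (Num f)) \<in> rswn_ideal c"
| Bminus_Bplus: "commutator (gen (Bminus f)) (gen (Bplus g))
    - (scalar (2 * complex_of_real c * inner_fun f g)
       + free_scale 4 (gen (Num (conj_fun f * g)))) \<in> rswn_ideal c"
| Num_Bplus: "commutator (gen (Num a)) (gen (Bplus f))
    - free_scale 2 (gen (Bplus (a * f))) \<in> rswn_ideal c"
| Bplus_Bplus: "commutator (gen (Bplus f)) (gen (Bplus g)) \<in> rswn_ideal c"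
| Bminus_Bminus: "commutator (gen (Bminus f)) (gen (Bminus g)) \<in> rswn_ideal c"
| Num_Num: "commutator (gen (Num a)) (gen (Num b)) \<in> rswn_ideal c"
| ideal_zero: "0 \<in> rswn_ideal c"
| ideal_add: "x \<in> rswn_ideal c \<Longrightarrow> y \<in> rswn_ideal c \<Longrightarrow> x + y \<in> rswn_ideal c"
| ideal_mult_left: "x \<in> rswn_ideal c \<Longrightarrow> y * x \<in> rswn_ideal c"
| ideal_mult_right: "x \<in> rswn_ideal c \<Longrightarrow> x * y \<in> rswn_ideal c"
| ideal_star: "x \<in> rswn_ideal c \<Longrightarrow> star x \<in> rswn_ideal c"

definition rswn_state :: "real \<Rightarrow> ('d::finite rswn_free \<Rightarrow> complex) \<Rightarrow> bool" where
  "rswn_state c \<phi> \<longleftrightarrow> Vector_Spaces.linear free_scale (*) \<phi> \<and>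
     (\<forall>x\<in>rswn_ideal c. \<phi> x = 0) \<and> (\<forall>x. \<phi> (star x * x) \<in> \<real>\<^sub>\<ge>\<^sub>0) \<and> \<phi> 1 = 1"

definition fock_state :: "real \<Rightarrow> ('d::finite rswn_free \<Rightarrow> complex) \<Rightarrow> bool" where
  "fock_state c \<phi> \<longleftrightarrow> rswn_state c \<phi> \<and>
     (\<forall>x g. \<phi> (x * gen (Bminus g)) = 0) \<and> (\<forall>x f. \<phi> (x * gen (Num f)) = 0)"

text \<open>\<open>gns_space \<phi> \<iota>\<close>: the Hilbert space \<open>'h\<close>, together with the map \<open>\<iota>\<close> sending \<open>x\<close> to the class of
  \<open>x\<close>, is the GNS Hilbert space of \<open>\<phi>\<close>, i.e. the completion of the algebra modulo the null space of
  the form $(x, y) \mapsto \varphi(x^* y)$. The cyclic vector is \<open>\<iota> 1\<close>, and \<open>b\<close> acts by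
  \<open>\<iota> x \<mapsto> \<iota> (b * x)\<close>, so that $b\,\Phi$ is \<open>\<iota> b\<close>.\<close>

definition gns_space ::
  "('d::finite rswn_free \<Rightarrow> complex) \<Rightarrow> ('d rswn_free \<Rightarrow> 'h::complex_hilbert) \<Rightarrow> bool" where
  "gns_space \<phi> \<iota> \<longleftrightarrow> Vector_Spaces.linear free_scale scaleC \<iota> \<and>
     (\<forall>x y. cinner (\<iota> x) (\<iota> y) = \<phi> (star x * y)) \<and> closure (range \<iota>) = UNIV"

section \<open>Exponential vectors and second quantization\<close>

definition exp_term :: "('d::finite rswn_free \<Rightarrow> 'h::complex_hilbert) \<Rightarrow> 'd L2Linf \<Rightarrow> nat \<Rightarrow> 'h" where
  "exp_term \<iota> f n = (1 / fact n) *\<^sub>R \<iota> (gen (Bplus f) ^ n)"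

definition exp_vector_exists :: "('d::finite rswn_free \<Rightarrow> 'h::complex_hilbert) \<Rightarrow> 'd L2Linf \<Rightarrow> bool" where
  "exp_vector_exists \<iota> f \<longleftrightarrow> summable (exp_term \<iota> f)"

definition exp_vector :: "('d::finite rswn_free \<Rightarrow> 'h::complex_hilbert) \<Rightarrow> 'd L2Linf \<Rightarrow> 'h" where
  "exp_vector \<iota> f = suminf (exp_term \<iota> f)"

definition exp_span :: "('d::finite rswn_free \<Rightarrow> 'h::complex_hilbert) \<Rightarrow> 'h set" where
  "exp_span \<iota> = module.span scaleC {exp_vector \<iota> f | f. linf_norm f < 1 / 2}"

text \<open>\<open>G\<close> is (on \<^const>\<open>exp_span\<close>) the second quantization of \<open>T\<close>; such a \<open>G\<close> exists iff the second
  quantization is well defined.\<close>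

definition is_second_quantization :: "('d::finite rswn_free \<Rightarrow> 'h::complex_hilbert) \<Rightarrow>
    ('d L2Linf \<Rightarrow> 'd L2Linf) \<Rightarrow> ('h \<Rightarrow> 'h) \<Rightarrow> bool" where
  "is_second_quantization \<iota> T G \<longleftrightarrow>
     (\<forall>f. linf_norm f < 1 / 2 \<longrightarrow>
        exp_vector_exists \<iota> (T f) \<and> G (exp_vector \<iota> f) = exp_vector \<iota> (T f)) \<and>
     (\<forall>x\<in>exp_span \<iota>. \<forall>y\<in>exp_span \<iota>. G (x + y) = G x + G y) \<and>
     (\<forall>z. \<forall>x\<in>exp_span \<iota>. G (z *\<^sub>C x) = z *\<^sub>C G x)"

definition second_quantization_isometry :: "('d::finite rswn_free \<Rightarrow> 'h::complex_hilbert) \<Rightarrow>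
    ('d L2Linf \<Rightarrow> 'd L2Linf) \<Rightarrow> bool" where
  "second_quantization_isometry \<iota> T \<longleftrightarrow>
     (\<exists>G V. is_second_quantization \<iota> T G \<and> hilbert_isometry V \<and> (\<forall>x\<in>exp_span \<iota>. V x = G x))"

definition second_quantization_unitary :: "('d::finite rswn_free \<Rightarrow> 'h::complex_hilbert) \<Rightarrow>
    ('d L2Linf \<Rightarrow> 'd L2Linf) \<Rightarrow> bool" where
  "second_quantization_unitary \<iota> T \<longleftrightarrow>
     (\<exists>G V. is_second_quantization \<iota> T G \<and> hilbert_unitary V \<and> (\<forall>x\<in>exp_span \<iota>. V x = G x))"

end

theory Submission
  imports Defs
begin

text \<open>The inner product of the $n$-particle vectors $B_f^{+n}\Phi$ and $B_g^{+n}\Phi$ is a universal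
  polynomial in the moments $\int (\bar f g)^k$, $1 \le k \le n$, in which the $n$-th moment occurs with
  a nonzero coefficient. Comparing coefficients in $z \mapsto \Psi(z f)$, the operator
  $\Gamma_2(T)$ is therefore isometric iff $T$ preserves all these moments. Polarising the moments of
  order at most three yields $T(f \bar g h) = Tf\, \overline{Tg}\, Th$. Applied to indicators of the balls
  of radius $n$ this shows that their images $u_n$ have modulus $0$ or $1$ and are restrictions of one
  unimodular function $u$, and $\bar u\, T$ is a $*$-endomorphism. If $\Gamma_2(T)$ is unitary, its
  restriction to one-particle vectors shows that $T$ has dense range in $L^2$, and the identity
  $T(f \chi_E) = Tf\, |T\chi_E|^2$ shows that an $L^2$-preimage of a bounded function is bounded.\<close>

section \<open>The algebra as functions\<close>

text \<open>Triple products enter because of the phase: with T = e^{i alpha} T_1 the product T f T g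
  carries the phase twice, while in T f conj(T g) T h one factor cancels, so this is the simplest
  product that such a \<open>T\<close> respects. Its squared defect expands into inner products of
  products of up to three functions; order three comes from there. Two obstacles shape the rest. The
  algebra has no unit, since R^d has infinite measure, so the phase cannot be read off from T 1 and
  is glued from images of balls; where all those images vanish, every T f vanishes too, because f is
  approximated in L^2 by its restrictions to balls and \<open>T\<close> is isometric. And the
  algebra is not complete for its inner product, so an isometry with dense range need not be onto:
  approximate preimages of h converge in L^2 only, to some F. If |h| <= C, then on a set E of finite
  measure where F is bounded and |F| > C the image of F chi_E is h |T chi_E|^2, of squared norm at
  most C^2 |E|; isometry forces E to be null.\<close>

lemma rep_L2Linf: "rep_L2Linf f \<in> L2Linf_fun"
  using Quotient3_rep_reflp[OF Quotient3_L2Linf, of f] by (auto simp: L2Linf_rel_def)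

lemma rep_abs_L2Linf: "f \<in> L2Linf_fun \<Longrightarrow> AE s in lborel. rep_L2Linf (abs_L2Linf f) s = f s"
  using Quotient3_rep_abs[OF Quotient3_L2Linf, of f] by (auto simp: L2Linf_rel_def)

text \<open>Used to prove identities in the algebra pointwise, from the \<open>rep_\<close> lemmas
  for the single operations.\<close>

lemma L2Linf_eq_iff: "f = g \<longleftrightarrow> (AE s in lborel. rep_L2Linf f s = rep_L2Linf g s)"
  using Quotient3_rel_rep[OF Quotient3_L2Linf, of f g] rep_L2Linf[of f] rep_L2Linf[of g]
  by (auto simp: L2Linf_rel_def)

lemma rep_measurable [measurable]: "rep_L2Linf f \<in> borel_measurable borel"
  using rep_L2Linf[of f] by (simp add: L2Linf_fun_def)

lemma rep_integrable_sq: "integrable lborel (\<lambda>s. (norm (rep_L2Linf f s))\<^sup>2)"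
  using rep_L2Linf[of f] by (simp add: L2Linf_fun_def)

lemma rep_bounded: obtains C where "C > 0" "AE s in lborel. norm (rep_L2Linf f s) \<le> C"
proof -
  obtain C where C: "AE s in lborel. norm (rep_L2Linf f s) \<le> C"
    using rep_L2Linf[of f] by (auto simp: L2Linf_fun_iff)
  have "AE s in lborel. norm (rep_L2Linf f s) \<le> max C 1"
    using C by eventually_elim simp
  with that[of "max C 1"] show ?thesis by simp
qed

lemma rep_times: "AE s in lborel. rep_L2Linf (f * g) s = rep_L2Linf f s * rep_L2Linf g s"
  unfolding times_L2Linf_def map_fun_def o_def id_def
  by (rule rep_abs_L2Linf) (intro L2Linf_fun_mult rep_L2Linf)

lemma rep_plus: "AE s in lborel. rep_L2Linf (f + g) s = rep_L2Linf f s + rep_L2Linf g s"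
  unfolding plus_L2Linf_def map_fun_def o_def id_def
  by (rule rep_abs_L2Linf) (intro L2Linf_fun_add rep_L2Linf)

lemma rep_scale: "AE s in lborel. rep_L2Linf (z *\<^sub>C f) s = z * rep_L2Linf f s"
  unfolding scaleC_L2Linf_def map_fun_def o_def id_def
  by (rule rep_abs_L2Linf) (intro L2Linf_fun_scale rep_L2Linf)

lemma rep_conj: "AE s in lborel. rep_L2Linf (conj_fun f) s = cnj (rep_L2Linf f s)"
  unfolding conj_fun_def map_fun_def o_def id_def
  by (rule rep_abs_L2Linf) (intro L2Linf_fun_cnj rep_L2Linf)

lemma rep_zero: "AE s in lborel. rep_L2Linf 0 s = 0"
  unfolding zero_L2Linf_def by (rule rep_abs_L2Linf) (rule L2Linf_fun_zero)

lemma rep_minus: "AE s in lborel. rep_L2Linf (f - g) s = rep_L2Linf f s - rep_L2Linf g s"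
  unfolding minus_L2Linf_def using rep_plus[of f "-1 *\<^sub>C g"] rep_scale[of "-1" g]
  by eventually_elim simp

lemma inner_fun_eq: "inner_fun f g = (\<integral>s. cnj (rep_L2Linf f s) * rep_L2Linf g s \<partial>lborel)"
  by (simp add: inner_fun_def)

lemma linf_norm_eq: "linf_norm f = esssup lborel (\<lambda>s. ereal (norm (rep_L2Linf f s)))"
  by (simp add: linf_norm_def)

lemma is_phase_mult_eq: "is_phase_mult \<alpha> f g \<longleftrightarrow>
    (AE s in lborel. rep_L2Linf g s = exp (\<i> * complex_of_real (\<alpha> s)) * rep_L2Linf f s)"
  by (simp add: is_phase_mult_def)

lemma integrable_inner: "integrable lborel (\<lambda>s. cnj (rep_L2Linf f s) * rep_L2Linf g s)"
proof (rule Bochner_Integration.integrable_bound)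
  show "integrable lborel (\<lambda>s. (norm (rep_L2Linf f s))\<^sup>2 + (norm (rep_L2Linf g s))\<^sup>2)"
    by (intro Bochner_Integration.integrable_add rep_integrable_sq)
  have "norm a * norm b \<le> (norm a)\<^sup>2 + (norm b)\<^sup>2" for a b :: complex
    using sum_squares_bound[of "norm a" "norm b"] mult_nonneg_nonneg[OF norm_ge_zero norm_ge_zero, of a b]
    by (simp only: mult.assoc)
  then show "AE s in lborel. norm (cnj (rep_L2Linf f s) * rep_L2Linf g s)
      \<le> norm ((norm (rep_L2Linf f s))\<^sup>2 + (norm (rep_L2Linf g s))\<^sup>2)"
    by (intro AE_I2) (simp add: norm_mult)
qed simp

lemma conj_conj [simp]: "conj_fun (conj_fun f) = f"
  unfolding L2Linf_eq_iff using rep_conj[of f] rep_conj[of "conj_fun f"] by eventually_elim simp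

lemma conj_times: "conj_fun (f * g) = conj_fun f * conj_fun g"
  unfolding L2Linf_eq_iff using rep_conj[of f] rep_conj[of g] rep_conj[of "f * g"] rep_times[of f g]
    rep_times[of "conj_fun f" "conj_fun g"] by eventually_elim simp

lemma inner_fun_commute: "inner_fun f g = cnj (inner_fun g f)"
  unfolding inner_fun_eq by (subst Bochner_Integration.integral_cnj[symmetric]) (simp add: mult.commute del: Bochner_Integration.integral_cnj)

lemma inner_fun_add_right: "inner_fun f (g + h) = inner_fun f g + inner_fun f h"
proof -
  have "inner_fun f (g + h) = (\<integral>s. cnj (rep_L2Linf f s) * rep_L2Linf g s +
      cnj (rep_L2Linf f s) * rep_L2Linf h s \<partial>lborel)"
    unfolding inner_fun_eq using rep_plus[of g h]
    by (intro integral_cong_AE) (auto simp: algebra_simps elim!: eventually_mono)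
  then show ?thesis
    by (simp add: inner_fun_eq integrable_inner Bochner_Integration.integral_add)
qed

lemma inner_fun_scale_right: "inner_fun f (z *\<^sub>C g) = z * inner_fun f g"
proof -
  have "inner_fun f (z *\<^sub>C g) = (\<integral>s. z * (cnj (rep_L2Linf f s) * rep_L2Linf g s) \<partial>lborel)"
    unfolding inner_fun_eq using rep_scale[of z g]
    by (intro integral_cong_AE) (auto simp: algebra_simps elim!: eventually_mono)
  then show ?thesis
    by (simp add: inner_fun_eq)
qed

lemma inner_fun_add_left: "inner_fun (f + g) h = inner_fun f h + inner_fun g h"
  using inner_fun_add_right[of h f g] inner_fun_commute[of _ h] by simp

lemma inner_fun_scale_left: "inner_fun (z *\<^sub>C g) f = cnj z * inner_fun g f"
  using inner_fun_scale_right[of f z g] inner_fun_commute[of _ f] by simp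

lemma inner_fun_minus_right: "inner_fun f (g - h) = inner_fun f g - inner_fun f h"
  by (simp add: minus_L2Linf_def inner_fun_add_right inner_fun_scale_right)

lemma inner_fun_minus_left: "inner_fun (f - g) h = inner_fun f h - inner_fun g h"
  by (simp add: minus_L2Linf_def inner_fun_add_left inner_fun_scale_left)

text \<open>Adjoint of a multiplication operator; it later moves conjugated factors across the inner
  product and so turns moments into inner products of powers.\<close>

lemma inner_fun_conj_times_left: "inner_fun (conj_fun a * f) g = inner_fun f (a * g)"
  unfolding inner_fun_eq
  using rep_times[of a g] rep_times[of "conj_fun a" f] rep_conj[of a]
  by (intro integral_cong_AE) (auto elim!: eventually_elim2 simp: ac_simps)

lemma inner_fun_conj_times_right: "inner_fun f (conj_fun a * g) = inner_fun (a * f) g"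
  using inner_fun_conj_times_left[of "conj_fun a" f g] by simp

lemma inner_fun_self: "inner_fun f f = of_real (\<integral>s. (norm (rep_L2Linf f s))\<^sup>2 \<partial>lborel)"
proof -
  have "cnj z * z = of_real ((norm z)\<^sup>2)" for z
    by (metis complex_norm_square mult.commute)
  then show ?thesis unfolding inner_fun_eq by (simp only: integral_complex_of_real)
qed

lemma inner_fun_self_eq_0: "inner_fun f f = 0 \<Longrightarrow> f = 0"
proof -
  assume "inner_fun f f = 0"
  then have "(\<integral>s. (norm (rep_L2Linf f s))\<^sup>2 \<partial>lborel) = 0" by (simp add: inner_fun_self)
  then have "AE s in lborel. (norm (rep_L2Linf f s))\<^sup>2 = 0"
    using integral_nonneg_eq_0_iff_AE[OF rep_integrable_sq[of f]] by simp
  then show "f = 0" unfolding L2Linf_eq_iff using rep_zero by eventually_elim simp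
qed

lemma clinear_add: "clinear T \<Longrightarrow> T (x + y) = T x + T y"
  and clinear_scale: "clinear T \<Longrightarrow> T (z *\<^sub>C x) = z *\<^sub>C T x"
  by (simp_all add: Vector_Spaces.linear_iff)

global_interpretation cvs: vector_space "scaleC :: complex \<Rightarrow> 'a \<Rightarrow> 'a::complex_vector"
  by standard (simp_all add: scaleC_add_right scaleC_add_left scaleC_scaleC scaleC_one)

lemma clinearI:
  assumes "\<And>x y. T (x + y) = T x + T y" "\<And>z x. T (z *\<^sub>C x) = z *\<^sub>C T x"
  shows "clinear T"
  unfolding Vector_Spaces.linear_iff using assms by (auto intro: cvs.vector_space_axioms)

lemma clinear_zero: "clinear T \<Longrightarrow> T 0 = 0"
  using clinear_scale[of T 0 0] by simp

lemma clinear_diff: "clinear T \<Longrightarrow> T (x - y) = T x - T y"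
  by (metis add_diff_cancel clinear_add diff_add_cancel)

section \<open>Hilbert spaces and the Fock representation\<close>

lemma cinner_add_left: "cinner ((x :: 'h::complex_hilbert) + y) z = cinner x z + cinner y z"
  by (metis cinner_add_right cinner_commute complex_cnj_add)

lemma cinner_scaleC_left: "cinner (a *\<^sub>C (x :: 'h::complex_hilbert)) y = cnj a * cinner x y"
  by (metis cinner_scaleC_right cinner_commute complex_cnj_mult)

lemma cinner_zero_right [simp]: "cinner (x :: 'h::complex_hilbert) 0 = 0"
  using cinner_add_right[of x 0 0] by simp

lemma cinner_zero_left [simp]: "cinner 0 (x :: 'h::complex_hilbert) = 0"
  using cinner_add_left[of 0 0 x] by simp

lemma cinner_minus_right: "cinner x (- (y :: 'h::complex_hilbert)) = - cinner x y"
  using cinner_add_right[of x y "-y"] by (simp add: add_eq_0_iff)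

lemma cinner_minus_left: "cinner (- (y :: 'h::complex_hilbert)) x = - cinner y x"
  using cinner_add_left[of y "-y" x] by (simp add: add_eq_0_iff)

lemma cinner_diff_right: "cinner (x :: 'h::complex_hilbert) (y - z) = cinner x y - cinner x z"
  using cinner_add_right[of x y "-z"] by (simp add: cinner_minus_right)

lemma cinner_diff_left: "cinner ((x :: 'h::complex_hilbert) - y) z = cinner x z - cinner y z"
  using cinner_add_left[of x "-y" z] by (simp add: cinner_minus_left)

lemma cinner_self_eq_0: "cinner x x = 0 \<longleftrightarrow> (x :: 'h::complex_hilbert) = 0"
  by (simp add: cinner_self_norm)

lemma cinner_scaleR_right: "cinner x (r *\<^sub>R y) = of_real r * cinner (x :: 'h::complex_hilbert) y"
  by (metis cinner_scaleC_right scaleC_of_real)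

lemma norm_scaleC: "norm (z *\<^sub>C (x :: 'h::complex_hilbert)) = norm z * norm x"
proof -
  have "complex_of_real ((norm (z *\<^sub>C x))\<^sup>2) = cinner (z *\<^sub>C x) (z *\<^sub>C x)"
    by (simp only: cinner_self_norm)
  also have "\<dots> = (cnj z * z) * complex_of_real ((norm x)\<^sup>2)"
    by (simp only: cinner_scaleC_left cinner_scaleC_right cinner_self_norm[of x] mult.assoc mult.left_commute)
  also have "\<dots> = complex_of_real ((norm z * norm x)\<^sup>2)"
    by (simp only: power_mult_distrib of_real_mult complex_norm_square[of z] mult.commute)
  finally have "(norm (z *\<^sub>C x))\<^sup>2 = (norm z * norm x)\<^sup>2" by (simp only: of_real_eq_iff)
  then show ?thesis by (rule power2_eq_imp_eq) simp_all
qed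

lemma cauchy_schwarz: "norm (cinner x y) \<le> norm x * norm (y :: 'h::complex_hilbert)"
proof (cases "y = 0")
  case False
  define a where "a = cinner y x"
  define N where "N = (norm y)\<^sup>2"
  have N: "N > 0" using False by (simp add: N_def)
  have yy: "cinner y y = of_real N" by (simp add: N_def cinner_self_norm)
  have xy: "cinner x y = cnj a" by (simp add: a_def cinner_commute[of x y])
  \<comment> \<open>\<open>v\<close> is the component of \<open>x\<close> orthogonal to
    \<open>y\<close>; the inequality says that its squared norm is nonnegative.\<close>
  define v where "v = x - (a / of_real N) *\<^sub>C y"
  have "cinner v v = cinner x x - of_real ((norm a)\<^sup>2 / N)"
    using N unfolding v_def
    by (simp add: cinner_diff_left cinner_diff_right cinner_scaleC_left cinner_scaleC_right yy xy
        a_def[symmetric] complex_norm_square field_simps del: of_real_power)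
  then have "complex_of_real ((norm v)\<^sup>2) = complex_of_real ((norm x)\<^sup>2 - (norm a)\<^sup>2 / N)"
    by (simp add: cinner_self_norm del: of_real_power)
  then have "(norm x)\<^sup>2 - (norm a)\<^sup>2 / N = (norm v)\<^sup>2" by (simp only: of_real_eq_iff)
  then have "(norm x)\<^sup>2 - (norm a)\<^sup>2 / N \<ge> 0" by simp
  then have "(norm a)\<^sup>2 \<le> (norm x * norm y)\<^sup>2"
    using N by (simp add: field_simps N_def power_mult_distrib)
  then have "norm a \<le> norm x * norm y"
    by (rule power2_le_imp_le) simp
  then show ?thesis by (simp add: xy)
qed simp

lemma bounded_linear_cinner: "bounded_linear (cinner (x :: 'h::complex_hilbert))"
  by (rule bounded_linear_intro[where K = "norm x"])
    (simp_all add: cinner_add_right cinner_scaleR_right cauchy_schwarz scaleR_conv_of_real mult.commute[of _ "norm x"])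

lemma bounded_linear_scaleC: "bounded_linear (\<lambda>x :: 'h::complex_hilbert. z *\<^sub>C x)"
  by (rule bounded_linear_intro[where K = "norm z"])
    (simp_all add: scaleC_add_right norm_scaleC scaleC_scaleC mult.commute flip: scaleC_of_real)

section \<open>Involution on the free algebra\<close>

lemma poly_mapping_monomial_induct [case_names zero add]:
  assumes "P 0" "\<And>w z x. P x \<Longrightarrow> P (Poly_Mapping.single w z + x)"
  shows "P (x :: 'a \<Rightarrow>\<^sub>0 'b::comm_monoid_add)"
proof (induction x rule: update_induct)
  case (update f a b)
  have "Poly_Mapping.update a b f = Poly_Mapping.single a b + f"
    using update by (intro poly_mapping_eqI)
      (auto simp: lookup_update lookup_add lookup_single when_def not_in_keys_iff_lookup_eq_zero)
  then show ?case using assms(2) update by simp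
qed (rule assms)

text \<open>The sum defining \<open>star\<close> runs over the support of \<open>x\<close>; a common
  larger index set makes additivity a termwise matter.\<close>

lemma star_eq_sum:
  assumes "finite A" "Poly_Mapping.keys x \<subseteq> A"
  shows "star x = (\<Sum>w\<in>A. Poly_Mapping.single (star_word w) (cnj (Poly_Mapping.lookup x w)))"
  unfolding star_def using assms by (intro sum.mono_neutral_left) (auto simp: in_keys_iff)

lemma star_single: "star (Poly_Mapping.single w z) = Poly_Mapping.single (star_word w) (cnj z)"
  by (subst star_eq_sum[where A = "{w}"]) auto

lemma star_zero [simp]: "star 0 = 0"
  by (simp add: star_def)

lemma star_add: "star (x + y) = star x + star y"
proof -
  let ?A = "Poly_Mapping.keys x \<union> Poly_Mapping.keys y"
  have "Poly_Mapping.keys (x + y) \<subseteq> ?A" by (rule keys_add)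
  then show ?thesis
    by (subst (1 2 3) star_eq_sum[where A = ?A]) (auto simp: lookup_add single_add sum.distrib)
qed

lemma star_word_add: "star_word (v + w) = star_word w + star_word v"
  by (simp add: star_word_def plus_free_word_def)

lemma star_mult: "star (x * y) = star y * star x"
proof (induction x rule: poly_mapping_monomial_induct)
  case (add w z x)
  have "star (Poly_Mapping.single w z * y) = star y * star (Poly_Mapping.single w z)"
    by (induction y rule: poly_mapping_monomial_induct)
      (simp_all add: distrib_left distrib_right star_add mult_single star_single star_word_add mult.commute)
  with add show ?case by (simp add: star_add distrib_left distrib_right)
qed simp

lemma star_gen_gen: "star (gen a) = gen (star_gen a)"
  by (simp add: gen_def star_single star_word_def)

lemma star_gen_star_gen [simp]: "star_gen (star_gen a) = a"
  by (cases a) auto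

section \<open>GNS representation: the generators acting on the vacuum\<close>

locale fock_rep =
  fixes c :: real and \<phi> :: "'d::finite rswn_free \<Rightarrow> complex"
    and \<iota> :: "'d rswn_free \<Rightarrow> 'h::complex_hilbert"
  assumes c_pos: "c > 0" and fock: "fock_state c \<phi>" and gns: "gns_space \<phi> \<iota>"
begin

abbreviation create where "create f \<equiv> gen (Bplus f)"
abbreviation annihilate where "annihilate f \<equiv> gen (Bminus f)"
abbreviation number where "number f \<equiv> gen (Num f)"

lemma iota_add: "\<iota> (x + y) = \<iota> x + \<iota> y"
  and iota_scalar: "\<iota> (scalar z * x) = z *\<^sub>C \<iota> x"
  using gns by (simp_all add: gns_space_def Vector_Spaces.linear_iff)

lemma iota_zero [simp]: "\<iota> 0 = 0"
  using iota_add[of 0 0] by simp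

lemma iota_diff: "\<iota> (x - y) = \<iota> x - \<iota> y"
  by (metis add_diff_cancel iota_add diff_add_cancel)

lemma iota_dense: "closure (range \<iota>) = UNIV"
  using gns by (simp add: gns_space_def)

lemma cinner_iota: "cinner (\<iota> x) (\<iota> y) = \<phi> (star x * y)"
  using gns by (simp add: gns_space_def)

lemma iota_ideal: "x \<in> rswn_ideal c \<Longrightarrow> \<iota> x = 0"
  using fock ideal_mult_left[of x c "star x"]
  by (subst cinner_self_eq_0[symmetric]) (simp add: cinner_iota fock_state_def rswn_state_def)

lemma iota_annihilate [simp]: "\<iota> (annihilate f) = 0"
  and iota_number [simp]: "\<iota> (number f) = 0"
  using fock by (subst cinner_self_eq_0[symmetric], simp add: cinner_iota fock_state_def)+

lemma cinner_gen: "cinner (\<iota> x) (\<iota> (gen b * y)) = cinner (\<iota> (gen (star_gen b) * x)) (\<iota> y)"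
  by (simp add: cinner_iota star_mult star_gen_gen mult.assoc)

lemma cinner_create: "cinner (\<iota> x) (\<iota> (create f * y)) = cinner (\<iota> (annihilate f * x)) (\<iota> y)"
  using cinner_gen[of x "Bplus f" y] by simp

lemma cinner_annihilate: "cinner (\<iota> x) (\<iota> (annihilate f * y)) = cinner (\<iota> (create f * x)) (\<iota> y)"
  using cinner_gen[of x "Bminus f" y] by simp

text \<open>The adjoint relation \<open>cinner_gen\<close> moves the generator to the other side of
  the inner product, where only the classes of \<open>x\<close> and \<open>y\<close> are seen. Hence
  generators act on classes modulo null vectors.\<close>

lemma iota_cong: "\<iota> x = \<iota> y \<Longrightarrow> \<iota> (gen b * x) = \<iota> (gen b * y)"
proof -
  assume *: "\<iota> x = \<iota> y"
  let ?v = "gen b * x - gen b * y"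
  have "cinner (\<iota> ?v) (\<iota> ?v) = cinner (\<iota> ?v) (\<iota> (gen b * x)) - cinner (\<iota> ?v) (\<iota> (gen b * y))"
    by (simp add: iota_diff cinner_diff_right)
  also have "\<dots> = 0" by (simp only: cinner_gen *) simp
  finally show ?thesis by (simp add: cinner_self_eq_0 iota_diff)
qed

text \<open>As in \<open>iota_cong\<close>, the generator is moved away by its adjoint; the scalar
  then comes out by linearity of \<open>\<iota>\<close>.\<close>

lemma iota_gen_scalar: "\<iota> (gen b * (scalar z * x)) = z *\<^sub>C \<iota> (gen b * x)"
proof -
  let ?v = "gen b * (scalar z * x) - scalar z * (gen b * x)"
  have "cinner (\<iota> ?v) (\<iota> ?v) =
      cinner (\<iota> ?v) (\<iota> (gen b * (scalar z * x))) - cinner (\<iota> ?v) (z *\<^sub>C \<iota> (gen b * x))"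
    by (simp add: iota_diff cinner_diff_right iota_scalar)
  also have "\<dots> = 0" by (simp only: cinner_gen cinner_scaleC_right iota_scalar) simp
  finally show ?thesis by (simp add: cinner_self_eq_0 iota_diff iota_scalar)
qed

lemma iota_gen_scale: "\<iota> x = z *\<^sub>C \<iota> y \<Longrightarrow> \<iota> (gen b * x) = z *\<^sub>C \<iota> (gen b * y)"
  using iota_cong[of x "scalar z * y"] by (simp add: iota_scalar iota_gen_scalar)

lemma iota_ideal_mult: "x \<in> rswn_ideal c \<Longrightarrow> \<iota> (x * y) = 0"
  by (intro iota_ideal ideal_mult_right)

lemma create_add: "\<iota> (create (f + g) * x) = \<iota> (create f * x) + \<iota> (create g * x)"
  using iota_ideal_mult[OF Bplus_add, of f g x] by (simp add: algebra_simps iota_diff iota_add)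

lemma create_scale: "\<iota> (create (z *\<^sub>C f) * x) = z *\<^sub>C \<iota> (create f * x)"
  using iota_ideal_mult[OF Bplus_scale, of z f x]
  by (simp add: left_diff_distrib iota_diff iota_scalar mult.assoc)

lemma create_create: "\<iota> (create f * (create g * x)) = \<iota> (create g * (create f * x))"
  using iota_ideal_mult[OF Bplus_Bplus, of f g x]
  by (simp add: left_diff_distrib iota_diff mult.assoc commutator_def)

lemma annihilate_create: "\<iota> (annihilate f * (create g * x)) = \<iota> (create g * (annihilate f * x)) +
    (2 * complex_of_real c * inner_fun f g) *\<^sub>C \<iota> x + 4 *\<^sub>C \<iota> (number (conj_fun f * g) * x)"
  using iota_ideal_mult[OF Bminus_Bplus, of f g x]
  by (simp add: left_diff_distrib distrib_right iota_diff iota_add iota_scalar mult.assoc commutator_def)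
    (simp add: algebra_simps)

lemma number_create: "\<iota> (number a * (create f * x)) = \<iota> (create f * (number a * x)) +
    2 *\<^sub>C \<iota> (create (a * f) * x)"
  using iota_ideal_mult[OF Num_Bplus, of a f x]
  by (simp add: left_diff_distrib distrib_right iota_diff iota_add iota_scalar mult.assoc commutator_def)
    (simp add: algebra_simps)

text \<open>The number operator acts as a derivation and kills the vacuum, and creators commute, so
  each of the \<open>n\<close> factors contributes the same term. At \<open>n = 0\<close> the
  coefficient vanishes and the truncated \<open>n - 1\<close> is harmless.\<close>

lemma number_power: "\<iota> (number a * create f ^ n) = of_nat (2 * n) *\<^sub>C \<iota> (create (a * f) * create f ^ (n - 1))"
proof (induction n)
  case (Suc n)
  have "\<iota> (create f * (number a * create f ^ n)) =
      of_nat (2 * n) *\<^sub>C \<iota> (create (a * f) * create f ^ n)"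
  proof (cases n)
    case k: (Suc k)
    then show ?thesis using iota_gen_scale[OF Suc.IH, of "Bplus f"]
      by (simp add: create_create)
  qed (use iota_cong[of "number a" 0] in simp)
  then have "\<iota> (number a * create f ^ Suc n) = (of_nat (2 * n) + 2) *\<^sub>C \<iota> (create (a * f) * create f ^ n)"
    by (simp only: power_Suc number_create scaleC_add_left)
  then show ?case by (simp add: add.commute)
qed simp

text \<open>Passing one creator yields a scalar and a number operator. The latter, acting on the
  remaining \<open>k\<close> creators, gives \<open>8 * k\<close> equal terms by
  \<open>number_power\<close>, and the sum of 8 k over k < n is 4 n (n - 1). The coefficients vanish
  wherever the truncated exponents \<open>n - 1\<close> and \<open>n - 2\<close> would be
  wrong.\<close>

lemma annihilate_power: "\<iota> (annihilate f * create g ^ n) =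
    (of_nat (2 * n) * complex_of_real c * inner_fun f g) *\<^sub>C \<iota> (create g ^ (n - 1)) +
    of_nat (4 * n * (n - 1)) *\<^sub>C \<iota> (create (conj_fun f * g * g) * create g ^ (n - 2))"
proof (induction n)
  case (Suc n)
  define z where "z = complex_of_real c * inner_fun f g"
  let ?h = "conj_fun f * g * g"
  have "\<iota> (create g * (annihilate f * create g ^ n)) =
      (of_nat (2 * n) * z) *\<^sub>C \<iota> (create g ^ n) +
      of_nat (4 * n * (n - 1)) *\<^sub>C \<iota> (create ?h * create g ^ (n - 1))"
  proof -
    have "\<iota> (annihilate f * create g ^ n) = \<iota> (scalar (of_nat (2 * n) * z) * create g ^ (n - 1) +
        scalar (of_nat (4 * n * (n - 1))) * (create ?h * create g ^ (n - 2)))"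
      using Suc by (simp add: iota_add iota_scalar z_def mult.assoc)
    from iota_cong[OF this, of "Bplus g"]
    have e0: "\<iota> (create g * (annihilate f * create g ^ n)) =
      (of_nat (2 * n) * z) *\<^sub>C \<iota> (create g * create g ^ (n - 1)) +
      of_nat (4 * n * (n - 1)) *\<^sub>C \<iota> (create ?h * (create g * create g ^ (n - 2)))"
      by (simp only: distrib_left iota_add iota_gen_scalar create_create[of g ?h])
    have e1: "(of_nat (2 * n) * z) *\<^sub>C \<iota> (create g * create g ^ (n - 1)) =
        (of_nat (2 * n) * z) *\<^sub>C \<iota> (create g ^ n)"
    proof (cases n)
      case (Suc k)
      then show ?thesis by (simp only: diff_Suc_1 power_Suc)
    qed simp
    have e2: "of_nat (4 * n * (n - 1)) *\<^sub>C \<iota> (create ?h * (create g * create g ^ (n - 2))) =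
        of_nat (4 * n * (n - 1)) *\<^sub>C \<iota> (create ?h * create g ^ (n - 1))"
    proof (cases "n \<le> 1")
      case False
      then have "n - 1 = Suc (n - 2)" by simp
      then show ?thesis by (simp only: power_Suc)
    next
      case True
      then have "4 * n * (n - 1) = 0" by auto
      then show ?thesis by (simp only: of_nat_0 cvs.scale_zero_left)
    qed
    show ?thesis unfolding e0 e1 e2 ..
  qed
  note 1 = this
  have 2: "4 *\<^sub>C \<iota> (number (conj_fun f * g) * create g ^ n) =
      of_nat (8 * n) *\<^sub>C \<iota> (create ?h * create g ^ (n - 1))"
    by (simp add: number_power scaleC_scaleC)
  have 3: "of_nat (4 * n * (n - 1)) *\<^sub>C x + of_nat (8 * n) *\<^sub>C x = of_nat (4 * Suc n * n) *\<^sub>C x" for x :: 'h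
  proof -
    have "4 * n * (n - 1) + 8 * n = 4 * Suc n * n" by (cases n) (simp_all add: algebra_simps)
    then have "complex_of_nat (4 * n * (n - 1)) + of_nat (8 * n) = of_nat (4 * Suc n * n)"
      by (metis of_nat_add)
    then show ?thesis by (metis scaleC_add_left)
  qed
  have 4: "(of_nat (2 * n) * z) *\<^sub>C x + (2 * z) *\<^sub>C x = (of_nat (2 * Suc n) * z) *\<^sub>C x" for x :: 'h
  proof -
    have "of_nat (2 * n) * z + 2 * z = of_nat (2 * Suc n) * z" by (simp add: algebra_simps)
    then show ?thesis by (metis scaleC_add_left)
  qed
  have "\<iota> (annihilate f * create g ^ Suc n) =
     (of_nat (2 * n) * z) *\<^sub>C \<iota> (create g ^ n) +
      of_nat (4 * n * (n - 1)) *\<^sub>C \<iota> (create ?h * create g ^ (n - 1)) + (2 * z) *\<^sub>C \<iota> (create g ^ n) +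
      of_nat (8 * n) *\<^sub>C \<iota> (create ?h * create g ^ (n - 1))"
    by (simp only: power_Suc annihilate_create 1 2) (simp add: z_def mult.assoc)
  also have "\<dots> = ((of_nat (2 * n) * z) *\<^sub>C \<iota> (create g ^ n) + (2 * z) *\<^sub>C \<iota> (create g ^ n)) +
     (of_nat (4 * n * (n - 1)) *\<^sub>C \<iota> (create ?h * create g ^ (n - 1)) +
      of_nat (8 * n) *\<^sub>C \<iota> (create ?h * create g ^ (n - 1)))"
    by (simp only: add.assoc add.left_commute add.commute)
  also have "\<dots> = (of_nat (2 * Suc n) * z) *\<^sub>C \<iota> (create g ^ n) +
      of_nat (4 * Suc n * n) *\<^sub>C \<iota> (create ?h * create g ^ (n - 1))"
    by (simp only: 3 4)
  moreover have "Suc n - 1 = n" "Suc n - 2 = n - 1" by simp_all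
  ultimately show ?case by (simp only: z_def mult.assoc)
qed simp

end

text \<open>The difference quotients at 0 lie in \<open>S\<close>, and so does their limit. This
  lets a closed subspace absorb polarisation.\<close>

lemma closed_subspace_vector_derivative:
  fixes f :: "real \<Rightarrow> 'h::complex_hilbert"
  assumes der: "(f has_vector_derivative D) (at 0)" and "closed S" "cvs.subspace S"
    and mem: "\<And>t. f t \<in> S"
  shows "D \<in> S"
proof -
  let ?q = "\<lambda>t. (1 / t) *\<^sub>R (f t - f 0)"
  have "((\<lambda>t. norm ((f t - f 0) - t *\<^sub>R D) / norm t) \<longlongrightarrow> 0) (at 0)"
    using der by (simp add: has_vector_derivative_def has_derivative_iff_norm)
  moreover have "\<forall>\<^sub>F t in at 0. norm ((f t - f 0) - t *\<^sub>R D) / norm t = norm (?q t - D)"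
  proof (rule eventually_mono[OF eventually_at_ball'[of 1 0 UNIV]])
    fix t :: real assume "t \<in> ball 0 1 \<and> t \<noteq> 0 \<and> t \<in> UNIV"
    then have "?q t - D = (1 / t) *\<^sub>R ((f t - f 0) - t *\<^sub>R D)" by (simp add: scaleR_diff_right)
    then show "norm ((f t - f 0) - t *\<^sub>R D) / norm t = norm (?q t - D)"
      by (simp only: norm_scaleR) simp
  qed simp
  ultimately have "((\<lambda>t. norm (?q t - D)) \<longlongrightarrow> 0) (at 0)"
    by (rule Lim_transform_eventually)
  then have lim: "(?q \<longlongrightarrow> D) (at 0)"
    by (intro LIM_zero_cancel[of ?q]) (rule tendsto_norm_zero_cancel)
  have "?q t \<in> S" for t
    unfolding scaleC_of_real[symmetric]
    by (intro cvs.subspace_scale[OF assms(3)] cvs.subspace_diff[OF assms(3)] mem)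
  then show ?thesis
    by (intro Lim_in_closed_set[OF \<open>closed S\<close> _ _ lim]) auto
qed

section \<open>Particle levels, orthogonality and totality of the powers of creators\<close>

context fock_rep
begin

definition particles :: "'d L2Linf list \<Rightarrow> 'd rswn_free" where
  "particles fs = prod_list (map (\<lambda>f. gen (Bplus f)) fs)"

lemma particles_Nil [simp]: "particles [] = 1"
  and particles_Cons [simp]: "particles (f # fs) = create f * particles fs"
  by (simp_all add: particles_def)

lemma iota_gen_span:
  assumes U: "cvs.subspace U" and gen: "\<And>x. x \<in> A \<Longrightarrow> \<iota> (gen b * x) \<in> U"
    and "\<iota> y \<in> cvs.span (\<iota> ` A)"
  shows "\<iota> (gen b * y) \<in> U"
proof -
  \<comment> \<open>\<open>\<iota>\<close> is not injective, so the claim is made for every preimage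
    of \<open>v\<close>; \<open>iota_cong\<close> settles \<open>v = 0\<close>.\<close>
  have "\<forall>y. \<iota> y = v \<longrightarrow> \<iota> (gen b * y) \<in> U" if "v \<in> cvs.span (\<iota> ` A)" for v
    using that
  proof (induction rule: cvs.span_induct_alt)
    case base
    show ?case using iota_cong[of _ 0 b] cvs.subspace_0[OF U] by simp
  next
    case (step z x v)
    then obtain a where a: "a \<in> A" "x = \<iota> a" by auto
    show ?case
    proof (intro allI impI)
      fix y assume y: "\<iota> y = z *\<^sub>C x + v"
      then have "\<iota> (y - scalar z * a) = v" by (simp add: iota_diff iota_scalar a)
      with step have *: "\<iota> (gen b * (y - scalar z * a)) \<in> U" by blast
      have "\<iota> (gen b * y) = z *\<^sub>C \<iota> (gen b * a) + \<iota> (gen b * (y - scalar z * a))"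
        by (simp add: right_diff_distrib iota_diff iota_gen_scalar)
      then show "\<iota> (gen b * y) \<in> U"
        using U * gen[OF a(1)] by (simp add: cvs.subspace_add cvs.subspace_scale)
    qed
  qed
  with assms(3) show ?thesis by blast
qed

text \<open>The algebraic n-particle space. Creators raise it by one, number operators preserve it
  and annihilators lower it by one.\<close>

definition level :: "nat \<Rightarrow> 'h set" where
  "level n = cvs.span (\<iota> ` (particles ` {fs. length fs = n}))"

lemma particles_level: "\<iota> (particles fs) \<in> level (length fs)"
  unfolding level_def by (intro cvs.span_base) auto

lemma subspace_level: "cvs.subspace (level n)"
  by (simp add: level_def)

lemma create_level: "\<iota> x \<in> level n \<Longrightarrow> \<iota> (create f * x) \<in> level (Suc n)"
proof (rule iota_gen_span[OF subspace_level, where A = "particles ` {fs. length fs = n}"])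
  fix x assume "x \<in> particles ` {fs. length fs = n}"
  then obtain fs where "x = particles fs" "length fs = n" by blast
  then show "\<iota> (create f * x) \<in> level (Suc n)" using particles_level[of "f # fs"] by simp
qed (simp add: level_def)

lemma number_level: "\<iota> (number a * particles fs) \<in> level (length fs)"
proof (induction fs)
  case Nil
  show ?case by (simp add: cvs.subspace_0[OF subspace_level])
next
  case (Cons f fs)
  have "\<iota> (create f * (number a * particles fs)) \<in> level (Suc (length fs))"
    by (rule create_level[OF Cons.IH])
  moreover have "\<iota> (create (a * f) * particles fs) \<in> level (Suc (length fs))"
    using particles_level[of "a * f # fs"] by simp
  ultimately show ?case
    by (simp add: number_create cvs.subspace_add[OF subspace_level] cvs.subspace_scale[OF subspace_level])
qed

text \<open>Commuting the annihilator past \<open>f\<close> leaves a creator applied to the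
  inductive case, a scalar term and a number term, all on level \<open>length fs\<close>.\<close>

lemma annihilate_level: "\<iota> (annihilate g * particles (f # fs)) \<in> level (length fs)"
proof (induction fs arbitrary: f)
  case Nil
  have "\<iota> (create f * annihilate g) = 0" using iota_cong[of "annihilate g" 0 "Bplus f"] by simp
  then show ?case
    using annihilate_create[of g f 1] particles_level[of "[]"] cvs.subspace_scale[OF subspace_level]
    by simp
next
  case (Cons h fs)
  show ?case
    using create_level[OF Cons.IH[of h]] particles_level[of "h # fs"] number_level[of _ "h # fs"]
    by (simp only: particles_Cons[of f] annihilate_create list.size
        cvs.subspace_add[OF subspace_level] cvs.subspace_scale[OF subspace_level] add_Suc_right add_0_right)
qed

text \<open>Creators of the longer product cross over as annihilators, each lowering the level on
  the left by one. The left side reaches the vacuum first, and the next annihilator kills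
  it.\<close>

lemma cinner_particles_less: "length fs < length gs \<Longrightarrow> cinner (\<iota> (particles fs)) (\<iota> (particles gs)) = 0"
proof (induction gs arbitrary: fs)
  case (Cons g gs)
  show ?case
  proof (cases fs)
    case Nil
    then show ?thesis by (simp add: cinner_create)
  next
    case (Cons f fs')
    have "cinner v (\<iota> (particles gs)) = 0" if "v \<in> level (length fs')" for v
      using that unfolding level_def
    proof (induction rule: cvs.span_induct_alt)
      case (step z x y)
      then show ?case using Cons.IH Cons Cons.prems
        by (auto simp: cinner_add_left cinner_scaleC_left)
    qed simp
    from this[OF annihilate_level] show ?thesis
      by (simp add: cinner_create Cons)
  qed
qed simp

lemma particles_replicate: "particles (replicate n f) = create f ^ n"
  by (induction n) simp_all

lemma cinner_power_neq: "n \<noteq> m \<Longrightarrow> cinner (\<iota> (create f ^ n)) (\<iota> (create g ^ m)) = 0"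
proof (cases "n < m")
  case True
  then show ?thesis
    using cinner_particles_less[of "replicate n f" "replicate m g"] by (simp add: particles_replicate)
next
  case False
  moreover assume "n \<noteq> m"
  ultimately have "cinner (\<iota> (create g ^ m)) (\<iota> (create f ^ n)) = 0"
    using cinner_particles_less[of "replicate m g" "replicate n f"] by (simp add: particles_replicate)
  then show ?thesis by (subst cinner_commute) simp
qed

lemma create_power_cong: "\<iota> x = \<iota> y \<Longrightarrow> \<iota> (create f ^ n * x) = \<iota> (create f ^ n * y)"
proof (induction n)
  case (Suc n)
  then show ?case unfolding power_Suc mult.assoc by (intro iota_cong) blast
qed simp

lemma create_power_scalar: "\<iota> (create f ^ n * (scalar z * x)) = z *\<^sub>C \<iota> (create f ^ n * x)"
proof (induction n)
  case (Suc n)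
  then show ?case unfolding power_Suc mult.assoc by (rule iota_gen_scale)
qed (simp add: iota_scalar)

lemma create_power_commute: "\<iota> (create f ^ n * (create g * x)) = \<iota> (create g * (create f ^ n * x))"
proof (induction n)
  case (Suc n)
  then show ?case using iota_cong[OF Suc, of "Bplus f"] by (simp add: mult.assoc create_create)
qed simp

text \<open>Polarisation: differentiating \<open>B\<^sup>+\<close> powers along \<open>g + t h\<close> at \<open>t = 0\<close> produces mixed products.\<close>

lemma create_power_has_vector_derivative:
  "((\<lambda>t. \<iota> (create (g + complex_of_real t *\<^sub>C h) ^ n * x)) has_vector_derivative
     of_nat n *\<^sub>C \<iota> (create h * (create g ^ (n - 1) * x))) (at 0)"
proof (induction n arbitrary: x)
  case 0
  show ?case by simp
next
  case (Suc n)
  let ?A = "\<lambda>t. create (g + complex_of_real t *\<^sub>C h)"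
  \<comment> \<open>Expanding one factor leaves two powers of exponent \<open>n\<close>. In the
    product rule at 0 the derivative of the second one is multiplied by 0, so only its value there
    counts.\<close>
  have eq: "\<iota> (?A t ^ Suc n * x) = \<iota> (?A t ^ n * (create g * x)) + t *\<^sub>R \<iota> (?A t ^ n * (create h * x))" for t
  proof -
    have "\<iota> (?A t ^ Suc n * x) = \<iota> (?A t ^ n * (?A t * x))"
      by (simp only: power_Suc2 mult.assoc)
    also have "\<dots> = \<iota> (?A t ^ n * (create g * x + scalar t * (create h * x)))"
      by (rule create_power_cong) (simp add: create_add create_scale iota_add iota_scalar)
    finally show ?thesis
      by (simp add: distrib_left iota_add create_power_scalar scaleC_of_real)
  qed
  have der: "((\<lambda>t. \<iota> (?A t ^ n * (create g * x)) + t *\<^sub>R \<iota> (?A t ^ n * (create h * x))) has_vector_derivative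
     (of_nat n *\<^sub>C \<iota> (create h * (create g ^ (n - 1) * (create g * x))) +
      (0 *\<^sub>R (of_nat n *\<^sub>C \<iota> (create h * (create g ^ (n - 1) * (create h * x)))) +
       1 *\<^sub>R \<iota> (?A 0 ^ n * (create h * x))))) (at 0)"
    by (intro has_vector_derivative_add has_vector_derivative_scaleR Suc.IH DERIV_ident)
  have 1: "of_nat n *\<^sub>C \<iota> (create h * (create g ^ (n - 1) * (create g * x))) =
      of_nat n *\<^sub>C \<iota> (create h * (create g ^ n * x))"
    by (cases n) (simp_all add: power_Suc2 mult.assoc del: power_Suc)
  have 2: "?A 0 = create g" by simp
  show ?case
    using der unfolding eq 1 2 create_power_commute
    by (simp only: scaleR_zero_left scaleR_one add_0_left diff_Suc_1 of_nat_Suc scaleC_add_left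
        scaleC_one add.commute)
qed

text \<open>Polarisation puts all mixed products of creators into \<open>S\<close>. Their span
  \<open>U\<close> is invariant under every generator, hence contains all words applied to the
  vacuum, that is, the dense range of \<open>\<iota>\<close>.\<close>

lemma total:
  assumes S: "closed S" "cvs.subspace S" and pow: "\<And>f n. \<iota> (create f ^ n) \<in> S"
  shows "S = UNIV"
proof -
  have mixed: "\<iota> (create g ^ n * particles fs) \<in> S" for g n fs
  proof (induction fs arbitrary: g n)
    case (Cons h fs)
    \<comment> \<open>Differentiation turns one factor \<open>g\<close> into \<open>h\<close>, so
      exponent \<open>Suc n\<close> is used to arrive at \<open>n\<close>.\<close>
    have "of_nat (Suc n) *\<^sub>C \<iota> (create h * (create g ^ (Suc n - 1) * particles fs)) \<in> S"
      by (rule closed_subspace_vector_derivative[OF create_power_has_vector_derivative S]) (rule Cons.IH)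
    from cvs.subspace_scale[OF S(2) this, of "1 / of_nat (Suc n)"] show ?case
      by (simp add: create_power_commute del: of_nat_Suc)
  qed (use pow in simp)
  define U where "U = cvs.span (\<iota> ` range particles)"
  have U: "cvs.subspace U" by (simp add: U_def)
  have lev: "level n \<subseteq> U" for n
    unfolding U_def level_def by (intro cvs.span_mono) auto
  have "\<iota> (gen b * particles fs) \<in> U" for b fs
  proof (cases b)
    case (Bplus f)
    have "\<iota> (particles (f # fs)) \<in> U" unfolding U_def by (intro cvs.span_base) blast
    then show ?thesis using Bplus by simp
  next
    case (Bminus f)
    show ?thesis
    proof (cases fs)
      case (Cons g gs)
      show ?thesis unfolding Bminus Cons by (rule subsetD[OF lev annihilate_level])
    qed (simp add: Bminus cvs.subspace_0[OF U])
  next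
    case (Num f)
    show ?thesis unfolding Num by (rule subsetD[OF lev number_level])
  qed
  then have step: "\<iota> (gen b * x) \<in> U" if "\<iota> x \<in> U" for b x
    using iota_gen_span[OF U, of "range particles" b x] that by (auto simp: U_def)
  have word: "\<iota> (Poly_Mapping.single (Word l) 1) \<in> U" for l
  proof (induction l)
    case Nil
    have "\<iota> (particles []) \<in> U" unfolding U_def by (intro cvs.span_base) blast
    then show ?case by (simp flip: zero_free_word_def)
  next
    case (Cons b l)
    have "Poly_Mapping.single (Word (b # l)) 1 = gen b * Poly_Mapping.single (Word l) 1"
      by (simp add: gen_def mult_single plus_free_word_def)
    then show ?case using step[OF Cons] by simp
  qed
  have "\<iota> x \<in> U" for x
  proof (induction x rule: poly_mapping_monomial_induct)
    case (add w z x)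
    have "Poly_Mapping.single w z = scalar z * Poly_Mapping.single (Word (letters w)) 1"
      by (simp add: scalar_def mult_single)
    with add word[of "letters w"] show ?case
      by (simp add: iota_add iota_scalar cvs.subspace_add[OF U] cvs.subspace_scale[OF U])
  qed (simp add: cvs.subspace_0[OF U])
  moreover have "U \<subseteq> S"
    unfolding U_def using mixed[of _ 0] by (intro cvs.span_minimal S) auto
  ultimately have "range \<iota> \<subseteq> S" by blast
  then show ?thesis
    using closure_minimal[OF _ S(1)] iota_dense by blast
qed

end

section \<open>Inner products of particle vectors\<close>

text \<open>The function (conj(f) g)^k g, written as an iteration because the algebra has no unit to
  serve as a zeroth power.\<close>

definition hpow :: "'d::finite L2Linf \<Rightarrow> 'd L2Linf \<Rightarrow> nat \<Rightarrow> 'd L2Linf" where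
  "hpow f g k = ((*) (conj_fun f * g) ^^ k) g"

text \<open>\<open>moment f g k\<close> is $\int (\bar f g)^{k+1}$.\<close>

definition moment :: "'d::finite L2Linf \<Rightarrow> 'd L2Linf \<Rightarrow> nat \<Rightarrow> complex" where
  "moment f g k = inner_fun f (hpow f g k)"

lemma hpow_0 [simp]: "hpow f g 0 = g"
  and hpow_Suc: "hpow f g (Suc k) = conj_fun f * g * hpow f g k"
  by (simp_all add: hpow_def)

text \<open>It identifies the function that \<open>annihilate_power\<close> produces from
  \<open>hpow f g k\<close> and powers of \<open>f\<close>; the recursion for inner products
  therefore stays within the \<open>hpow\<close> family, with \<open>f\<close> and \<open>g\<close>
  exchanged.\<close>

lemma conj_hpow: "conj_fun (hpow f g k) * f * f = hpow g f (Suc k)"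
proof (induction k)
  case (Suc k)
  have "conj_fun (hpow f g (Suc k)) * f * f = conj_fun g * f * (conj_fun (hpow f g k) * f * f)"
    by (simp add: hpow_Suc conj_times ac_simps)
  then show ?case by (simp only: Suc hpow_Suc)
qed (simp add: hpow_Suc mult.assoc)

lemma inner_fun_hpow_left: "inner_fun (hpow g f k) g = moment f g k"
proof -
  have "inner_fun (hpow g f k) y = inner_fun f (((*) (conj_fun f * g) ^^ k) y)" for y
  proof (induction k arbitrary: y)
    case (Suc k)
    have "inner_fun (hpow g f (Suc k)) y = inner_fun (conj_fun (conj_fun f * g) * hpow g f k) y"
      by (simp add: hpow_Suc conj_times mult.commute)
    then show ?case
      by (simp add: inner_fun_conj_times_left Suc funpow_Suc_right del: funpow.simps)
  qed simp
  then show ?thesis by (simp add: moment_def hpow_def)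
qed

text \<open>\<open>gram c J m k\<close> is the inner product of $B^{+m}_f\Phi$ with
  $B^+_{(\bar f g)^k g} B^{+(m-1)}_g\Phi$ when \<open>J\<close> is the sequence of moments of \<open>f\<close> and \<open>g\<close>;
  the value at \<open>m = 0\<close> matters for \<open>k = 0\<close> only.\<close>

primrec gram :: "real \<Rightarrow> (nat \<Rightarrow> complex) \<Rightarrow> nat \<Rightarrow> nat \<Rightarrow> complex" where
  "gram c J 0 k = 1"
| "gram c J (Suc m) k = of_nat (2 * Suc m) * complex_of_real c * J k * gram c J m 0 +
     of_nat (4 * Suc m * m) * gram c J m (Suc k)"

text \<open>The coefficient of \<open>J (k + m)\<close> in \<open>gram c J (Suc m) k\<close>: this
  top index is reached only along the branch that raises \<open>k\<close> at each step.\<close>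

primrec gram_lead :: "real \<Rightarrow> nat \<Rightarrow> complex" where
  "gram_lead c 0 = 2 * complex_of_real c"
| "gram_lead c (Suc m) = of_nat (4 * Suc (Suc m) * Suc m) * gram_lead c m"

lemma gram_lead_nonzero: "c > 0 \<Longrightarrow> gram_lead c m \<noteq> 0"
  by (induction m) (simp_all only: gram_lead.simps mult_eq_0_iff of_nat_eq_0_iff, auto)

text \<open>When the lower moments and all values at \<open>k = 0\<close> agree, the product terms
  of the recursion cancel and only the branch raising \<open>k\<close> survives.\<close>

lemma gram_diff:
  assumes "\<And>m. gram c J m 0 = gram c J' m 0" "\<And>i. i < k + m \<Longrightarrow> J i = J' i"
  shows "gram c J (Suc m) k - gram c J' (Suc m) k = gram_lead c m * (J (k + m) - J' (k + m))"
  using assms(2)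
proof (induction m arbitrary: k)
  case 0
  show ?case by (simp add: algebra_simps)
next
  case (Suc m)
  have "J k = J' k" using Suc.prems by simp
  moreover have "gram c J (Suc m) (Suc k) - gram c J' (Suc m) (Suc k) =
      gram_lead c m * (J (Suc k + m) - J' (Suc k + m))"
    using Suc.prems by (intro Suc.IH) simp
  ultimately have "gram c J (Suc (Suc m)) k - gram c J' (Suc (Suc m)) k =
      of_nat (4 * Suc (Suc m) * Suc m) * (gram_lead c m * (J (Suc k + m) - J' (Suc k + m)))"
    using assms(1)[of "Suc m"] unfolding gram.simps(2)[of c _ "Suc m"]
    by (simp only: right_diff_distrib[symmetric] add_diff_cancel_left)
  then show ?case by (simp only: gram_lead.simps mult.assoc add_Suc_right add_Suc)
qed

text \<open>The dependence on the moments is triangular: once those below \<open>k\<close> agree,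
  the value at \<open>Suc k\<close> isolates \<open>J k\<close> with a nonzero coefficient.\<close>

lemma gram_inj:
  assumes "c > 0" "\<And>m. gram c J m 0 = gram c J' m 0"
  shows "J k = J' k"
proof (induction k rule: less_induct)
  case (less k)
  then have "gram c J (Suc k) 0 - gram c J' (Suc k) 0 = gram_lead c k * (J (0 + k) - J' (0 + k))"
    by (intro gram_diff assms) simp
  then show ?case using assms(2)[of "Suc k"] gram_lead_nonzero[OF assms(1)] by simp
qed

text \<open>The Taylor coefficients of (1 - q x)^(-K/q), or of exp(K x) if q = 0; their successive
  ratios tend to \<open>q\<close>.\<close>

primrec gram_bound :: "real \<Rightarrow> real \<Rightarrow> nat \<Rightarrow> real" where
  "gram_bound K q 0 = 1"
| "gram_bound K q (Suc m) = gram_bound K q m * ((K + q * real m) / real (Suc m))"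

lemma gram_bound_nonneg: "K \<ge> 0 \<Longrightarrow> q \<ge> 0 \<Longrightarrow> gram_bound K q m \<ge> 0"
  by (induction m) simp_all

text \<open>Inserting the bound on \<open>J\<close> makes both terms of the recursion multiples of
  s^k, with sum (m + 1)(2 c A + 4 s m); this gives the parameters 2 c A and 4 s. The value of
  \<open>gram\<close> at \<open>m = 0\<close> is 1 for every \<open>k\<close>, hence the proviso;
  the recursion meets it there with coefficient 0.\<close>

lemma norm_gram_le:
  assumes "c > 0" "A \<ge> 0" "s \<ge> 0" and J: "\<And>k. norm (J k) \<le> A * s ^ k"
  shows "m > 0 \<or> k = 0 \<Longrightarrow> norm (gram c J m k) \<le> s ^ k * gram_bound (2 * c * A) (4 * s) m * (fact m)\<^sup>2"
proof (induction m arbitrary: k)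
  case (Suc m)
  let ?g = "gram_bound (2 * c * A) (4 * s) m * (fact m)\<^sup>2"
  have g0: "?g \<ge> 0" using assms by (simp add: gram_bound_nonneg)
  have 1: "norm (of_nat (2 * Suc m) * complex_of_real c * J k * gram c J m 0)
      \<le> real (2 * Suc m) * c * (A * s ^ k) * ?g"
    using Suc.IH[of 0] assms(1-3) J[of k] unfolding norm_mult norm_of_nat norm_of_real
    by (intro mult_mono mult_nonneg_nonneg) auto
  have 2: "norm (of_nat (4 * Suc m * m) * gram c J m (Suc k)) \<le> real (4 * Suc m * m) * (s ^ Suc k * ?g)"
  proof (cases "m = 0")
    case False
    then show ?thesis
      using Suc.IH[of "Suc k"] unfolding norm_mult norm_of_nat
      by (intro mult_left_mono) (simp_all add: mult.assoc)
  qed simp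
  have "norm (gram c J (Suc m) k) \<le> real (2 * Suc m) * c * (A * s ^ k) * ?g + real (4 * Suc m * m) * (s ^ Suc k * ?g)"
    unfolding gram.simps by (rule norm_triangle_le[OF add_mono[OF 1 2]])
  also have "\<dots> = s ^ k * ?g * (real (Suc m) * (2 * c * A + 4 * s * real m))"
    by (simp add: algebra_simps)
  also have "real (Suc m) * (2 * c * A + 4 * s * real m) =
      ((2 * c * A + 4 * s * real m) / real (Suc m)) * (real (Suc m))\<^sup>2"
    by (simp add: power2_eq_square del: of_nat_Suc)
  also have "s ^ k * ?g * \<dots> = s ^ k * gram_bound (2 * c * A) (4 * s) (Suc m) * (fact (Suc m))\<^sup>2"
    by (simp only: gram_bound.simps fact_Suc power_mult_distrib of_nat_mult of_nat_fact) (simp only: mult.assoc mult.left_commute mult.commute)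
  finally show ?case .
qed simp

lemma summable_sqrt_gram_bound:
  assumes "K \<ge> 0" "0 \<le> q" "q < 1"
  shows "summable (\<lambda>n. sqrt (gram_bound K q n))"
proof -
  \<comment> \<open>Any ratio strictly between \<open>q\<close> and 1 would do; \<open>N\<close> is
    chosen so that \<open>K\<close> is absorbed by the gap \<open>r - q\<close>.\<close>
  define r where "r = (1 + q) / 2"
  have r: "q < r" "r < 1" "0 < r" using assms by (auto simp: r_def)
  obtain N :: nat where N: "K / (r - q) \<le> real N" using real_arch_simple by blast
  show ?thesis
  proof (rule summable_ratio_test)
    show "sqrt r < 1" using r by simp
    fix n assume "n \<ge> N"
    then have "K / (r - q) \<le> real n" using N by linarith
    then have "K \<le> (r - q) * real n" using r by (simp add: field_simps)
    then have "K + q * real n \<le> r * real n" by (simp add: algebra_simps)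
    also have "\<dots> \<le> r * real (Suc n)" using r by simp
    finally have "(K + q * real n) / real (Suc n) \<le> r" by (simp add: pos_divide_le_eq del: of_nat_Suc)
    then have "sqrt ((K + q * real n) / real (Suc n)) \<le> sqrt r" by simp
    then have "sqrt (gram_bound K q n) * sqrt ((K + q * real n) / real (Suc n)) \<le> sqrt (gram_bound K q n) * sqrt r"
      using assms gram_bound_nonneg[of K q n] by (intro mult_left_mono) simp_all
    then have "sqrt (gram_bound K q (Suc n)) \<le> sqrt r * sqrt (gram_bound K q n)"
      by (simp only: gram_bound.simps real_sqrt_mult mult.commute)
    moreover have "norm (sqrt (gram_bound K q k)) = sqrt (gram_bound K q k)" for k
      using gram_bound_nonneg[OF assms(1,2), of k] by simp
    ultimately show "norm (sqrt (gram_bound K q (Suc n))) \<le> sqrt r * norm (sqrt (gram_bound K q n))"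
      by (simp only:)
  qed
qed

lemma rep_hpow: "AE s in lborel. rep_L2Linf (hpow f g k) s =
    (cnj (rep_L2Linf f s) * rep_L2Linf g s) ^ k * rep_L2Linf g s"
proof (induction k)
  case (Suc k)
  then show ?case
    using rep_times[of "conj_fun f * g" "hpow f g k"] rep_times[of "conj_fun f" g] rep_conj[of f]
    by eventually_elim (simp add: hpow_Suc mult.assoc)
qed simp

lemma norm_moment_le:
  assumes C: "AE s in lborel. norm (rep_L2Linf f s) \<le> C"
  shows "norm (moment f f k) \<le> (\<integral>s. (norm (rep_L2Linf f s))\<^sup>2 \<partial>lborel) * (C\<^sup>2) ^ k"
proof -
  have "norm (moment f f k) \<le> (\<integral>s. norm (cnj (rep_L2Linf f s) * rep_L2Linf (hpow f f k) s) \<partial>lborel)"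
    unfolding moment_def inner_fun_eq by (rule integral_norm_bound)
  also have "\<dots> \<le> (\<integral>s. (norm (rep_L2Linf f s))\<^sup>2 * (C\<^sup>2) ^ k \<partial>lborel)"
  proof (rule integral_mono_AE)
    show "AE s in lborel. norm (cnj (rep_L2Linf f s) * rep_L2Linf (hpow f f k) s)
        \<le> (norm (rep_L2Linf f s))\<^sup>2 * (C\<^sup>2) ^ k"
      using C rep_hpow[of f f k]
    proof eventually_elim
      case (elim s)
      have "norm (cnj (rep_L2Linf f s) * rep_L2Linf (hpow f f k) s) =
          (norm (rep_L2Linf f s))\<^sup>2 * ((norm (rep_L2Linf f s))\<^sup>2) ^ k"
        by (simp add: elim norm_mult norm_power power2_eq_square)
      also have "\<dots> \<le> (norm (rep_L2Linf f s))\<^sup>2 * (C\<^sup>2) ^ k"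
        using elim by (intro mult_left_mono power_mono) auto
      finally show ?case .
    qed
  qed (intro integrable_norm integrable_inner integrable_mult_left rep_integrable_sq)+
  also have "\<dots> = (\<integral>s. (norm (rep_L2Linf f s))\<^sup>2 \<partial>lborel) * (C\<^sup>2) ^ k" by simp
  finally show ?thesis .
qed

lemma linf_norm_less_half:
  assumes "linf_norm f < 1 / 2"
  obtains C where "0 \<le> C" "C < 1 / 2" "AE s in lborel. norm (rep_L2Linf f s) \<le> C"
proof -
  obtain C where C: "linf_norm f < ereal C" "ereal C < 1 / 2"
    using ereal_dense2[OF assms] by blast
  have "ereal C < ereal (1 / 2)" using C(2) by (simp add: one_ereal_def numeral_eq_ereal)
  moreover have ae: "AE s in lborel. norm (rep_L2Linf f s) \<le> C"
    using esssup_AE[of "\<lambda>s. ereal (norm (rep_L2Linf f s))" lborel]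
  proof eventually_elim
    case (elim s)
    from le_less_trans[OF elim C(1)[unfolded linf_norm_eq]] show ?case by simp
  qed
  moreover have "AE s in lborel. norm (rep_L2Linf f s) \<le> max C 0"
    using ae by eventually_elim simp
  ultimately show ?thesis by (intro that[of "max C 0"]) auto
qed

text \<open>Provides the disc on which z -> Psi(z f) is defined for an arbitrary \<open>f\<close>.
  The radius 1 / (4 C) brings the sup norm down to 1/4, below the threshold 1/2.\<close>

lemma linf_norm_scaled_less_half:
  obtains \<delta> where "\<delta> > 0" "\<And>z. norm z \<le> \<delta> \<Longrightarrow> linf_norm (z *\<^sub>C f) < 1 / 2"
proof -
  obtain C where C: "C > 0" "AE s in lborel. norm (rep_L2Linf f s) \<le> C"
    by (rule rep_bounded)
  have "linf_norm (z *\<^sub>C f) < 1 / 2" if "norm z \<le> 1 / (4 * C)" for z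
  proof -
    have "AE s in lborel. ereal (norm (rep_L2Linf (z *\<^sub>C f) s)) \<le> ereal (1 / 4)"
      using C(2) rep_scale[of z f]
    proof eventually_elim
      case (elim s)
      have "norm z * norm (rep_L2Linf f s) \<le> 1 / (4 * C) * C"
        using elim that C(1) by (intro mult_mono) auto
      then show ?case using elim that C(1) by (simp add: norm_mult)
    qed
    then have "linf_norm (z *\<^sub>C f) \<le> ereal (1 / 4)"
      unfolding linf_norm_eq by (intro esssup_I) measurable
    also have "\<dots> < 1 / 2" by (simp add: one_ereal_def numeral_eq_ereal)
    finally show ?thesis .
  qed
  then show ?thesis using that[of "1 / (4 * C)"] C(1) by simp
qed

context fock_rep
begin

lemma cinner_iota_1: "cinner (\<iota> 1) (\<iota> 1) = 1"
proof -
  have "star (1 :: 'd rswn_free) = 1"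
    unfolding single_one[symmetric] star_single by (simp only: star_word_def zero_free_word_def) simp
  then show ?thesis using fock by (simp add: cinner_iota fock_state_def rswn_state_def)
qed

text \<open>Moving the mixed creator across and applying \<open>annihilate_power\<close> puts the
  next mixed creator on the opposite side, with the roles of \<open>f\<close> and \<open>g\<close>
  exchanged. The two forms are therefore proved together.\<close>

lemma cinner_mixed:
  "cinner (\<iota> (create f ^ Suc m)) (\<iota> (create (hpow f g k) * create g ^ m)) = gram c (moment f g) (Suc m) k \<and>
   cinner (\<iota> (create (hpow g f k) * create f ^ m)) (\<iota> (create g ^ Suc m)) = gram c (moment f g) (Suc m) k"
proof (induction m arbitrary: k)
  \<comment> \<open>The assumptions on mixed products carry their coefficient, which is 0 at
    \<open>m = 0\<close>, where \<open>m - 1\<close> has no meaning.\<close>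
  have step: "cinner (\<iota> (create f ^ Suc m)) (\<iota> (create (hpow f g k) * create g ^ m)) = gram c (moment f g) (Suc m) k \<and>
      cinner (\<iota> (create (hpow g f k) * create f ^ m)) (\<iota> (create g ^ Suc m)) = gram c (moment f g) (Suc m) k"
    if diag: "cinner (\<iota> (create f ^ m)) (\<iota> (create g ^ m)) = gram c (moment f g) m 0"
      and left: "of_nat (4 * Suc m * m) * cinner (\<iota> (create (hpow g f (Suc k)) * create f ^ (m - 1))) (\<iota> (create g ^ m))
        = of_nat (4 * Suc m * m) * gram c (moment f g) m (Suc k)"
      and right: "of_nat (4 * Suc m * m) * cinner (\<iota> (create f ^ m)) (\<iota> (create (hpow f g (Suc k)) * create g ^ (m - 1)))
        = of_nat (4 * Suc m * m) * gram c (moment f g) m (Suc k)" for m k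
  proof
    have sub: "Suc m - 1 = m" "Suc m - 2 = m - 1" by simp_all
    have "cinner (\<iota> (create f ^ Suc m)) (\<iota> (create (hpow f g k) * create g ^ m)) =
        of_nat (2 * Suc m) * complex_of_real c * cnj (inner_fun (hpow f g k) f) * cinner (\<iota> (create f ^ m)) (\<iota> (create g ^ m)) +
        of_nat (4 * Suc m * m) * cinner (\<iota> (create (hpow g f (Suc k)) * create f ^ (m - 1))) (\<iota> (create g ^ m))"
      by (simp only: cinner_create annihilate_power sub cinner_add_left cinner_scaleC_left conj_hpow
          complex_cnj_mult complex_cnj_of_nat complex_cnj_complex_of_real)
    then show "cinner (\<iota> (create f ^ Suc m)) (\<iota> (create (hpow f g k) * create g ^ m)) = gram c (moment f g) (Suc m) k"
      by (simp only: left diag gram.simps moment_def inner_fun_commute[of f "hpow f g k"])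
    have "cinner (\<iota> (create (hpow g f k) * create f ^ m)) (\<iota> (create g ^ Suc m)) =
        of_nat (2 * Suc m) * complex_of_real c * inner_fun (hpow g f k) g * cinner (\<iota> (create f ^ m)) (\<iota> (create g ^ m)) +
        of_nat (4 * Suc m * m) * cinner (\<iota> (create f ^ m)) (\<iota> (create (hpow f g (Suc k)) * create g ^ (m - 1)))"
      by (simp only: cinner_annihilate[symmetric] annihilate_power sub cinner_add_right cinner_scaleC_right conj_hpow)
    then show "cinner (\<iota> (create (hpow g f k) * create f ^ m)) (\<iota> (create g ^ Suc m)) = gram c (moment f g) (Suc m) k"
      by (simp only: right diag gram.simps inner_fun_hpow_left)
  qed
  {
    case 0
    show ?case by (rule step) (simp_all add: cinner_iota_1)
  next
    case (Suc m)
    show ?case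
    proof (rule step)
      show "cinner (\<iota> (create f ^ Suc m)) (\<iota> (create g ^ Suc m)) = gram c (moment f g) (Suc m) 0"
        using Suc[of 0] by simp
    qed (simp_all only: Suc diff_Suc_1)
  }
qed

lemma cinner_power: "cinner (\<iota> (create f ^ m)) (\<iota> (create g ^ m)) = gram c (moment f g) m 0"
proof (cases m)
  case (Suc n)
  then show ?thesis using cinner_mixed[of f n g 0] by simp
qed (simp add: cinner_iota_1)

text \<open>The squared norm of the n-th term is the diagonal inner product over (n!)^2, at most
  \<open>gram_bound\<close> with q = 4 C^2. The threshold 1/2 for \<open>C\<close> is exactly where
  \<open>q\<close> reaches 1.\<close>

lemma summable_exp_term:
  assumes "linf_norm f < 1 / 2"
  shows "summable (exp_term \<iota> f)"
proof -
  obtain C where C: "0 \<le> C" "C < 1 / 2" "AE s in lborel. norm (rep_L2Linf f s) \<le> C"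
    using linf_norm_less_half[OF assms] .
  define A where "A = (\<integral>s. (norm (rep_L2Linf f s))\<^sup>2 \<partial>lborel)"
  define q where "q = 4 * C\<^sup>2"
  have A: "A \<ge> 0" by (simp add: A_def)
  have "C * C < (1 / 2) * (1 / 2)" using C by (intro mult_strict_mono) auto
  then have q: "0 \<le> q" "q < 1" by (simp_all add: q_def power2_eq_square)
  have "norm (exp_term \<iota> f n) \<le> sqrt (gram_bound (2 * c * A) q n)" for n
  proof -
    have "complex_of_real ((norm (\<iota> (create f ^ n)))\<^sup>2) = gram c (moment f f) n 0"
      by (simp only: cinner_self_norm[symmetric] cinner_power)
    then have "(norm (\<iota> (create f ^ n)))\<^sup>2 = norm (gram c (moment f f) n 0)"
      by (metis abs_of_nonneg norm_of_real zero_le_power2)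
    also have "\<dots> \<le> gram_bound (2 * c * A) q n * (fact n)\<^sup>2"
      using norm_gram_le[OF c_pos A zero_le_power2 norm_moment_le[OF C(3), folded A_def], of n 0]
      by (simp add: q_def)
    finally have "(norm (exp_term \<iota> f n))\<^sup>2 \<le> gram_bound (2 * c * A) q n"
      by (simp add: exp_term_def power_mult_distrib power_divide field_simps)
    then show ?thesis by (rule real_le_rsqrt)
  qed
  moreover have "summable (\<lambda>n. sqrt (gram_bound (2 * c * A) q n))"
    by (rule summable_sqrt_gram_bound) (use A c_pos q in auto)
  ultimately show ?thesis
    by (intro summable_comparison_test'[where N = 0 and f = "exp_term \<iota> f"])
qed

end

section \<open>Second quantization and moments\<close>

text \<open>The limit at 0 gives \<open>a 0 = 0\<close>, then the series is divided by
  \<open>z\<close>; because of this division the hypothesis speaks of nonzero \<open>z\<close>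
  only.\<close>

lemma power_series_zero:
  fixes a :: "nat \<Rightarrow> complex"
  assumes "s > 0" "\<And>z. z \<noteq> 0 \<Longrightarrow> norm z < s \<Longrightarrow> (\<lambda>n. a n * z ^ n) sums 0"
  shows "a n = 0"
  using assms(2)
proof (induction n arbitrary: a)
  case 0
  have "(\<lambda>_ :: complex. 0) \<midarrow>0\<rightarrow> a 0"
    by (rule powser_limit_0_strong[where f = "\<lambda>_. 0", OF assms(1) 0])
  then show ?case by (rule LIM_const_eq[symmetric])
next
  case (Suc n)
  have "(\<lambda>_ :: complex. 0) \<midarrow>0\<rightarrow> a 0"
    by (rule powser_limit_0_strong[where f = "\<lambda>_. 0", OF assms(1) Suc.prems])
  then have a0: "a 0 = 0" by (rule LIM_const_eq[symmetric])
  have "(\<lambda>n. a (Suc n) * z ^ n) sums 0" if z: "z \<noteq> 0" "norm z < s" for z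
  proof -
    have "(\<lambda>n. a (Suc n) * z ^ Suc n) sums 0"
      using Suc.prems[OF z] a0 by (subst sums_Suc_iff) simp
    from sums_divide[OF this, of z] show ?thesis using z by simp
  qed
  then show ?case by (rule Suc.IH)
qed

section \<open>Isometries from equal Gram matrices\<close>

lemma subspace_closure:
  assumes "cvs.subspace (S :: 'h::complex_hilbert set)"
  shows "cvs.subspace (closure S)"
proof (rule cvs.subspaceI)
  show "0 \<in> closure S" using cvs.subspace_0[OF assms] closure_subset by blast
next
  fix x y assume "x \<in> closure S" "y \<in> closure S"
  then obtain a b where ab: "\<And>n. a n \<in> S" "a \<longlonglongrightarrow> x" "\<And>n. b n \<in> S" "b \<longlonglongrightarrow> y"
    unfolding closure_sequential by blast
  show "x + y \<in> closure S"
    unfolding closure_sequential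
    using ab by (intro exI[of _ "\<lambda>n. a n + b n"]) (auto intro: tendsto_add cvs.subspace_add[OF assms])
next
  fix z x assume "x \<in> closure S"
  then obtain a where a: "\<And>n. a n \<in> S" "a \<longlonglongrightarrow> x"
    unfolding closure_sequential by blast
  show "z *\<^sub>C x \<in> closure S"
    unfolding closure_sequential
    using a bounded_linear.tendsto[OF bounded_linear_scaleC a(2), of z]
    by (intro exI[of _ "\<lambda>n. z *\<^sub>C a n"]) (auto intro: cvs.subspace_scale[OF assms])
qed

lemma
  assumes "hilbert_isometry V"
  shows hilbert_isometry_linear: "clinear V"
    and hilbert_isometry_cinner: "cinner (V x) (V y) = cinner x y"
    and hilbert_isometry_norm: "norm (V x) = norm x"
    and hilbert_isometry_bounded_linear: "bounded_linear V"
proof -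
  show lin: "clinear V" and cin: "cinner (V x) (V y) = cinner x y" for x y
    using assms by (auto simp: hilbert_isometry_def)
  show norm: "norm (V x) = norm x" for x
  proof -
    have "complex_of_real ((norm (V x))\<^sup>2) = complex_of_real ((norm x)\<^sup>2)"
      by (simp only: cinner_self_norm[symmetric] cin)
    then have "(norm (V x))\<^sup>2 = (norm x)\<^sup>2" by (simp only: of_real_eq_iff)
    then show ?thesis by (simp add: power2_eq_iff_nonneg)
  qed
  show "bounded_linear V"
    by (rule bounded_linear_intro[where K = 1])
      (simp_all add: clinear_add[OF lin] norm clinear_scale[OF lin] flip: scaleC_of_real)
qed

text \<open>The span of the pairs (v i, w i): the graph of the linear map taking \<open>v i\<close>
  to \<open>w i\<close>, before it is known to be single valued.\<close>

inductive combination :: "('i \<Rightarrow> 'h::complex_hilbert) \<Rightarrow> ('i \<Rightarrow> 'h) \<Rightarrow> 'h \<Rightarrow> 'h \<Rightarrow> bool"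
  for v w where
  zero: "combination v w 0 0"
| add: "combination v w x y \<Longrightarrow> combination v w (z *\<^sub>C v i + x) (z *\<^sub>C w i + y)"

lemma combination_plus:
  assumes "combination v w x y" "combination v w x' y'"
  shows "combination v w (x + x') (y + y')"
  using assms(1) by induction (auto simp: assms(2) add.assoc intro: combination.add)

lemma combination_scale: "combination v w x y \<Longrightarrow> combination v w (a *\<^sub>C x) (a *\<^sub>C y)"
proof (induction rule: combination.induct)
  case (add x y z i)
  from combination.add[OF add.IH, of "a * z" i] show ?case
    by (simp add: scaleC_add_right scaleC_scaleC)
qed (simp add: combination.zero)

lemma combination_minus:
  assumes "combination v w x y" "combination v w x' y'"
  shows "combination v w (x - x') (y - y')"
  using combination_plus[OF assms(1) combination_scale[OF assms(2), of "-1"]] by simp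

lemma combination_base: "combination v w (v i) (w i)"
  using combination.add[OF combination.zero, of v w 1 i] by simp

lemma combination_cinner:
  assumes gram: "\<And>i j. cinner (w i) (w j) = cinner (v i) (v j)"
    and "combination v w x y" "combination v w x' y'"
  shows "cinner y y' = cinner x x'"
proof -
  have *: "cinner (w i) y' = cinner (v i) x'" for i
    using assms(3) by induction (simp_all add: cinner_add_right cinner_scaleC_right gram)
  show ?thesis
    using assms(2) by induction (simp_all add: cinner_add_left cinner_scaleC_left *)
qed

text \<open>Equal Gram matrices make the graph norm preserving, hence single valued and uniformly
  continuous on the span, and the map extends to the closure. Totality is phrased through closed
  subspaces to match \<open>total\<close>.\<close>

lemma isometry_extension:
  fixes v w :: "'i \<Rightarrow> 'h::complex_hilbert"
  assumes gram: "\<And>i j. cinner (w i) (w j) = cinner (v i) (v j)"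
    and total: "\<And>S. closed S \<Longrightarrow> cvs.subspace S \<Longrightarrow> range v \<subseteq> S \<Longrightarrow> S = UNIV"
  obtains V where "hilbert_isometry V" "\<And>i. V (v i) = w i"
proof -
  define X where "X = {x. \<exists>y. combination v w x y}"
  define f where "f x = (SOME y. combination v w x y)" for x
  have f: "combination v w x (f x)" if "x \<in> X" for x
    using that unfolding X_def f_def by (auto intro: someI)
  have norm: "norm y = norm x" if "combination v w x y" for x y
  proof -
    have "complex_of_real ((norm y)\<^sup>2) = complex_of_real ((norm x)\<^sup>2)"
      unfolding cinner_self_norm[symmetric] by (rule combination_cinner[OF gram that that])
    then have "(norm y)\<^sup>2 = (norm x)\<^sup>2" by (simp only: of_real_eq_iff)
    then show ?thesis by (simp add: power2_eq_iff_nonneg)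
  qed
  have f_eq: "f x = y" if "combination v w x y" for x y
  proof -
    have "x \<in> X" using that by (auto simp: X_def)
    from norm[OF combination_minus[OF f[OF this] that]] show ?thesis by simp
  qed
  have "cvs.subspace X"
    by (rule cvs.subspaceI)
      (auto simp: X_def intro: combination.zero combination_plus combination_scale)
  moreover have "range v \<subseteq> closure X"
    using closure_subset combination_base unfolding X_def by fast
  ultimately have dense: "closure X = UNIV"
    by (intro total subspace_closure) auto
  have "dist (f x) (f x') = dist x x'" if "x \<in> X" "x' \<in> X" for x x'
    unfolding dist_norm by (rule norm[OF combination_minus[OF f[OF that(1)] f[OF that(2)]]])
  then have "uniformly_continuous_on X f"
    unfolding uniformly_continuous_on_def by metis
  then obtain V where "uniformly_continuous_on (closure X) V" and Vf: "\<And>x. x \<in> X \<Longrightarrow> f x = V x"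
    using uniformly_continuous_on_extension_on_closure by metis
  then have cont: "continuous_on UNIV V"
    using uniformly_continuous_imp_continuous dense by auto
  have Vc: "V x = y" if "combination v w x y" for x y
  proof -
    have "x \<in> X" using that by (auto simp: X_def)
    with f_eq[OF that] Vf show ?thesis by simp
  qed
  \<comment> \<open>Each pair (x, V x) is a limit of pairs in the graph, and by \<open>Vlim\<close>
    below all limits of such pairs have this form. Linearity passes to the extension through these
    two facts.\<close>
  have lim: "\<exists>a b. a \<longlonglongrightarrow> x \<and> b \<longlonglongrightarrow> V x \<and> (\<forall>n. combination v w (a n) (b n))" for x
  proof -
    have "x \<in> closure X" by (simp add: dense)
    then obtain a where a: "\<And>n. a n \<in> X" "a \<longlonglongrightarrow> x" unfolding closure_sequential by blast
    have "(\<lambda>n. V (a n)) \<longlonglongrightarrow> V x"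
      using cont a(2) by (rule continuous_on_tendsto_compose) auto
    then have "(\<lambda>n. f (a n)) \<longlonglongrightarrow> V x" using Vf a(1) by simp
    then show ?thesis using a f by blast
  qed
  have Vlim: "V x = y" if "a \<longlonglongrightarrow> x" "b \<longlonglongrightarrow> y" "\<And>n. combination v w (a n) (b n)" for a b x y
  proof -
    have "(\<lambda>n. V (a n)) \<longlonglongrightarrow> V x"
      using cont that(1) by (rule continuous_on_tendsto_compose) auto
    then have "b \<longlonglongrightarrow> V x" using Vc[OF that(3)] by simp
    then show ?thesis using that(2) LIMSEQ_unique by blast
  qed
  have "clinear V"
  proof (rule clinearI)
    fix x y
    obtain a b where a: "a \<longlonglongrightarrow> x" "b \<longlonglongrightarrow> V x" "\<And>n. combination v w (a n) (b n)" using lim by metis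
    obtain a' b' where a': "a' \<longlonglongrightarrow> y" "b' \<longlonglongrightarrow> V y" "\<And>n. combination v w (a' n) (b' n)" using lim by metis
    show "V (x + y) = V x + V y"
      by (rule Vlim[OF tendsto_add[OF a(1) a'(1)] tendsto_add[OF a(2) a'(2)]])
        (intro combination_plus a a')
  next
    fix z x
    obtain a b where a: "a \<longlonglongrightarrow> x" "b \<longlonglongrightarrow> V x" "\<And>n. combination v w (a n) (b n)" using lim by metis
    show "V (z *\<^sub>C x) = z *\<^sub>C V x"
      by (rule Vlim[OF bounded_linear.tendsto[OF bounded_linear_scaleC a(1)]
            bounded_linear.tendsto[OF bounded_linear_scaleC a(2)]]) (intro combination_scale a)
  qed
  have Vnorm: "norm (V x) = norm x" for x
  proof -
    obtain a b where a: "a \<longlonglongrightarrow> x" "b \<longlonglongrightarrow> V x" "\<And>n. combination v w (a n) (b n)" using lim by metis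
    have "(\<lambda>n. norm (b n)) \<longlonglongrightarrow> norm (V x)" "(\<lambda>n. norm (b n)) \<longlonglongrightarrow> norm x"
      using tendsto_norm[OF a(1)] tendsto_norm[OF a(2)] norm[OF a(3)] by simp_all
    then show ?thesis by (rule LIMSEQ_unique)
  qed
  have "cinner (V x) (V y) = cinner x y" for x y
  proof -
    obtain a b where a: "a \<longlonglongrightarrow> x" "b \<longlonglongrightarrow> V x" "\<And>n. combination v w (a n) (b n)" using lim by metis
    \<comment> \<open>The limit is taken in one argument at a time, first against the generators
      \<open>w j\<close>.\<close>
    have left: "cinner (V x) (w j) = cinner x (v j)" for j
    proof -
      have "(\<lambda>n. cinner (w j) (b n)) \<longlonglongrightarrow> cinner (w j) (V x)"
        by (rule bounded_linear.tendsto[OF bounded_linear_cinner a(2)])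
      moreover have "(\<lambda>n. cinner (v j) (a n)) \<longlonglongrightarrow> cinner (v j) x"
        by (rule bounded_linear.tendsto[OF bounded_linear_cinner a(1)])
      moreover have "cinner (w j) (b n) = cinner (v j) (a n)" for n
        by (rule combination_cinner[OF gram combination_base a(3)])
      ultimately have "cinner (w j) (V x) = cinner (v j) x" by (auto intro: LIMSEQ_unique)
      then show ?thesis by (metis cinner_commute)
    qed
    obtain a' b' where a': "a' \<longlonglongrightarrow> y" "b' \<longlonglongrightarrow> V y" "\<And>n. combination v w (a' n) (b' n)" using lim by metis
    have eq: "cinner (V x) q = cinner x p" if "combination v w p q" for p q
      using that by induction (simp_all add: cinner_add_right cinner_scaleC_right left)
    have "(\<lambda>n. cinner (V x) (b' n)) \<longlonglongrightarrow> cinner (V x) (V y)"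
      by (rule bounded_linear.tendsto[OF bounded_linear_cinner a'(2)])
    moreover have "(\<lambda>n. cinner x (a' n)) \<longlonglongrightarrow> cinner x y"
      by (rule bounded_linear.tendsto[OF bounded_linear_cinner a'(1)])
    ultimately show ?thesis using eq[OF a'(3)] by (auto intro: LIMSEQ_unique)
  qed
  with \<open>clinear V\<close> have "hilbert_isometry V" by (simp add: hilbert_isometry_def)
  moreover have "V (v i) = w i" for i by (rule Vc[OF combination_base])
  ultimately show ?thesis by (rule that)
qed

section \<open>From second quantization to moments and back\<close>

context fock_rep
begin

lemma create_scale_power: "\<iota> (create (z *\<^sub>C f) ^ n) = z ^ n *\<^sub>C \<iota> (create f ^ n)"
proof (induction n)
  case (Suc n)
  show ?case
    using iota_gen_scale[OF Suc, of "Bplus f"] by (simp add: create_scale scaleC_scaleC)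
qed simp

lemma exp_vector_scale_sums:
  assumes "exp_vector_exists \<iota> (z *\<^sub>C f)"
  shows "(\<lambda>n. (z ^ n / fact n) *\<^sub>C \<iota> (create f ^ n)) sums exp_vector \<iota> (z *\<^sub>C f)"
proof -
  have "exp_term \<iota> (z *\<^sub>C f) = (\<lambda>n. (z ^ n / fact n) *\<^sub>C \<iota> (create f ^ n))"
    by (rule ext) (simp add: exp_term_def create_scale_power scaleC_scaleC flip: scaleC_of_real)
  then show ?thesis
    using summable_sums[of "exp_term \<iota> (z *\<^sub>C f)"] assms
    by (simp only: exp_vector_exists_def exp_vector_def)
qed

text \<open>Comparison of coefficients in the power series of \<open>V (\<Psi>(z f)) = \<Psi>(z T f)\<close> around \<open>z = 0\<close>.\<close>

lemma second_quantization_power: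
  assumes T: "clinear T" and sq: "is_second_quantization \<iota> T G" and V: "hilbert_isometry V"
    and VG: "\<And>x. x \<in> exp_span \<iota> \<Longrightarrow> V x = G x"
  shows "V (\<iota> (create f ^ n)) = \<iota> (create (T f) ^ n)"
proof -
  obtain \<delta> where \<delta>: "\<delta> > 0" "\<And>z. norm z \<le> \<delta> \<Longrightarrow> linf_norm (z *\<^sub>C f) < 1 / 2"
    by (rule linf_norm_scaled_less_half[of f]) auto
  \<comment> \<open>\<open>d n\<close> is the defect of the n-th coefficient. Pairing the
    vector-valued series with \<open>d n\<close> gives a scalar power series whose n-th coefficient
    is the squared norm of \<open>d n\<close> over n!.\<close>
  define d where "d n = V (\<iota> (create f ^ n)) - \<iota> (create (T f) ^ n)" for n
  have "(\<lambda>k. cinner (d n) (d k) / fact k * z ^ k) sums 0" if "norm z < \<delta>" for z n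
  proof -
    from that have lin: "linf_norm (z *\<^sub>C f) < 1 / 2" by (intro \<delta>) simp
    then have ex: "exp_vector_exists \<iota> (z *\<^sub>C f)"
      by (simp add: exp_vector_exists_def summable_exp_term)
    have ex': "exp_vector_exists \<iota> (z *\<^sub>C T f)" and
      G: "G (exp_vector \<iota> (z *\<^sub>C f)) = exp_vector \<iota> (z *\<^sub>C T f)"
      using sq lin by (auto simp: is_second_quantization_def clinear_scale[OF T, symmetric])
    have "exp_vector \<iota> (z *\<^sub>C f) \<in> exp_span \<iota>"
      unfolding exp_span_def using lin by (intro cvs.span_base) blast
    then have "V (exp_vector \<iota> (z *\<^sub>C f)) = exp_vector \<iota> (z *\<^sub>C T f)"
      using VG G by simp
    then have "(\<lambda>k. V ((z ^ k / fact k) *\<^sub>C \<iota> (create f ^ k))) sums exp_vector \<iota> (z *\<^sub>C T f)"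
      using bounded_linear.sums[OF hilbert_isometry_bounded_linear[OF V] exp_vector_scale_sums[OF ex]] by simp
    from sums_diff[OF this exp_vector_scale_sums[OF ex']]
    have "(\<lambda>k. (z ^ k / fact k) *\<^sub>C d k) sums 0"
      by (simp add: d_def clinear_scale[OF hilbert_isometry_linear[OF V]] cvs.scale_right_diff_distrib)
    from bounded_linear.sums[OF bounded_linear_cinner this, of "d n"] show ?thesis
      by (simp add: cinner_scaleC_right mult.commute)
  qed
  from power_series_zero[OF \<delta>(1) this, of n n]
  have "cinner (d n) (d n) = 0" by simp
  then show ?thesis by (simp add: cinner_self_eq_0 d_def)
qed

lemma isometry_imp_moment:
  assumes "clinear T" "second_quantization_isometry \<iota> T"
  shows "moment (T f) (T g) k = moment f g k"
proof -
  obtain G V where V: "is_second_quantization \<iota> T G" "hilbert_isometry V" "\<And>x. x \<in> exp_span \<iota> \<Longrightarrow> V x = G x"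
    using assms(2) unfolding second_quantization_isometry_def by blast
  have "gram c (moment (T f) (T g)) m 0 = gram c (moment f g) m 0" for m
    using hilbert_isometry_cinner[OF V(2), of "\<iota> (create f ^ m)" "\<iota> (create g ^ m)"]
    by (simp only: second_quantization_power[OF assms(1) V] cinner_power)
  then show ?thesis by (rule gram_inj[OF c_pos])
qed

text \<open>The family of all powers and the family of their images have equal Gram matrices: on one
  level by \<open>cinner_power\<close>, across levels because both entries vanish.\<close>

lemma moment_imp_isometry:
  assumes T: "clinear T" and mom: "\<And>f g k. moment (T f) (T g) k = moment f g k"
  obtains V where "hilbert_isometry V" "\<And>f n. V (\<iota> (create f ^ n)) = \<iota> (create (T f) ^ n)"
proof -
  let ?v = "\<lambda>(n, f). \<iota> (create f ^ n)" and ?w = "\<lambda>(n, f). \<iota> (create (T f) ^ n)"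
  have 1: "cinner (?w i) (?w j) = cinner (?v i) (?v j)" for i j
  proof (cases i; cases j)
    fix n f m g assume "i = (n, f)" "j = (m, g)"
    moreover have "moment (T f) (T g) = moment f g" using mom by blast
    ultimately show ?thesis by (cases "n = m") (simp_all add: cinner_power cinner_power_neq)
  qed
  have 2: "S = UNIV" if "closed S" "cvs.subspace S" "range ?v \<subseteq> S" for S
  proof (rule total[OF that(1,2)])
    show "\<iota> (create f ^ n) \<in> S" for f n using that(3) by (auto simp: image_subset_iff)
  qed
  obtain V where V: "hilbert_isometry V" "\<And>i. V (?v i) = ?w i"
    using isometry_extension[of ?w ?v, OF 1 2] by metis
  have "V (\<iota> (create f ^ n)) = \<iota> (create (T f) ^ n)" for f n
    using V(2)[of "(n, f)"] by simp
  with V(1) show ?thesis by (rule that)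
qed

text \<open>A bounded operator passes through the exponential series term by term; this also yields
  convergence of the series for \<open>T f\<close>.\<close>

lemma isometry_is_second_quantization:
  assumes V: "hilbert_isometry V" "\<And>f n. V (\<iota> (create f ^ n)) = \<iota> (create (T f) ^ n)"
  shows "is_second_quantization \<iota> T V"
proof -
  note lin = hilbert_isometry_linear[OF V(1)] and bl = hilbert_isometry_bounded_linear[OF V(1)]
  have "V (exp_term \<iota> f n) = exp_term \<iota> (T f) n" for f n
    by (simp add: exp_term_def V(2) linear_scale[OF bounded_linear.linear[OF bl]])
  then have "exp_term \<iota> (T f) sums V (exp_vector \<iota> f)" if "linf_norm f < 1 / 2" for f
    using bounded_linear.sums[OF bl summable_sums[OF summable_exp_term[OF that]]]
    by (simp add: exp_vector_def)
  then show ?thesis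
    by (auto simp: is_second_quantization_def exp_vector_exists_def clinear_add[OF lin]
        clinear_scale[OF lin] exp_vector_def sums_iff)
qed

text \<open>The range of an isometry is complete, hence closed, and surjectivity of \<open>T\<close>
  puts the total set of powers into it.\<close>

lemma isometry_surj:
  assumes V: "hilbert_isometry V" "\<And>f n. V (\<iota> (create f ^ n)) = \<iota> (create (T f) ^ n)"
    and "surj T"
  shows "surj V"
proof (rule total)
  note lin = hilbert_isometry_linear[OF V(1)]
  have "complete (range V)"
    using complete_isometric_image[of 1 UNIV V] hilbert_isometry_bounded_linear[OF V(1)]
    by (simp add: hilbert_isometry_norm[OF V(1)] complete_UNIV)
  then show "closed (range V)" by (rule complete_imp_closed)
  show "cvs.subspace (range V)"
  proof (rule cvs.subspaceI)
    show "0 \<in> range V" by (metis clinear_zero[OF lin] rangeI)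
  qed (auto simp flip: clinear_add[OF lin] clinear_scale[OF lin])
  show "\<iota> (create f ^ n) \<in> range V" for f n
    using V(2) assms(3) by (metis rangeI surjD)
qed

text \<open>A \<open>V\<close>-preimage of the one-particle vector of \<open>h\<close> is
  approximated by combinations of powers; the one-particle part of the approximation is given by
  some \<open>f\<close>, and passing to the one-particle part does not increase the error.\<close>

lemma surj_imp_dense:
  assumes T: "clinear T" and V: "hilbert_isometry V" "\<And>f n. V (\<iota> (create f ^ n)) = \<iota> (create (T f) ^ n)"
    and "surj V" and "\<epsilon> > 0"
  shows "\<exists>f. Re (inner_fun (T f - h) (T f - h)) < \<epsilon>"
proof -
  note lin = hilbert_isometry_linear[OF V(1)]
  have c1: "create f ^ Suc 0 = create f" for f :: "'d L2Linf" by simp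
  \<comment> \<open>Vectors split into a one-particle part and a remainder whose image is orthogonal
    to the one-particle space. Every power is of this form, so \<open>D\<close> is dense, without
    constructing a projection.\<close>
  define D where "D = {\<iota> (create f) + y | f y. (\<forall>g. cinner (\<iota> (create g)) (V y) = 0)}"
  have "cvs.subspace D"
  proof (rule cvs.subspaceI)
    have "\<iota> (create 0) = 0" using create_scale[of 0 0 1] by simp
    then show "0 \<in> D" unfolding D_def by (intro CollectI exI[of _ 0]) (simp add: clinear_zero[OF lin])
  next
    fix x y assume "x \<in> D" "y \<in> D"
    then obtain f a g b where "x = \<iota> (create f) + a" "\<forall>g. cinner (\<iota> (create g)) (V a) = 0"
        "y = \<iota> (create g) + b" "\<forall>g. cinner (\<iota> (create g)) (V b) = 0"
      unfolding D_def by blast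
    then show "x + y \<in> D" unfolding D_def using create_add[of f g 1]
      by (intro CollectI exI[of _ "f + g"] exI[of _ "a + b"]) (simp add: clinear_add[OF lin] cinner_add_right)
  next
    fix z x assume "x \<in> D"
    then obtain f a where "x = \<iota> (create f) + a" "\<forall>g. cinner (\<iota> (create g)) (V a) = 0"
      unfolding D_def by blast
    then show "z *\<^sub>C x \<in> D" unfolding D_def using create_scale[of z f 1]
      by (intro CollectI exI[of _ "z *\<^sub>C f"] exI[of _ "z *\<^sub>C a"])
        (simp add: clinear_scale[OF lin] cinner_scaleC_right scaleC_add_right)
  qed
  moreover have "\<iota> (create f ^ n) \<in> closure D" for f n
  proof -
    have "\<iota> (create f ^ n) \<in> D"
    proof (cases "n = 1")
      case True
      then show ?thesis unfolding D_def
        by (intro CollectI exI[of _ f] exI[of _ 0]) (simp add: clinear_zero[OF lin])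
    next
      case False
      have "\<iota> (create 0) = 0" using create_scale[of 0 0 1] by simp
      moreover have "cinner (\<iota> (create g)) (V (\<iota> (create f ^ n))) = 0" for g
        using cinner_power_neq[of 1 n g "T f"] False by (simp add: V(2))
      ultimately show ?thesis unfolding D_def
        by (intro CollectI exI[of _ 0] exI[of _ "\<iota> (create f ^ n)"]) simp
    qed
    then show ?thesis using closure_subset by blast
  qed
  ultimately have dense: "closure D = UNIV"
    by (intro total subspace_closure) auto
  \<comment> \<open>A one-particle vector has 2 c times the squared L^2 norm of its function, see
    \<open>uu\<close> below.\<close>
  define e where "e = sqrt (2 * c * \<epsilon>)"
  have e: "e > 0" using c_pos \<open>\<epsilon> > 0\<close> by (simp add: e_def)
  obtain w where w: "\<iota> (create h) = V w" using \<open>surj V\<close> by (metis surjD)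
  have "w \<in> closure D" by (simp add: dense)
  then obtain w' where w': "w' \<in> D" "dist w' w < e" using e unfolding closure_approachable by blast
  then obtain f y where y: "w' = \<iota> (create f) + y" "\<And>g. cinner (\<iota> (create g)) (V y) = 0"
    unfolding D_def by blast
  have Vf: "V (\<iota> (create f)) = \<iota> (create (T f))" using V(2)[of f 1] by simp
  define u where "u = T f - h"
  have u: "\<iota> (create u) = \<iota> (create (T f)) - \<iota> (create h)"
    using create_add[of u h 1] by (simp add: u_def)
  have "norm (\<iota> (create u) + V y) = norm (V (w' - w))"
    by (simp add: u w clinear_diff[OF lin] y(1) clinear_add[OF lin] Vf algebra_simps)
  then have less: "norm (\<iota> (create u) + V y) < e"
    using w'(2) by (simp add: hilbert_isometry_norm[OF V(1)] dist_norm)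
  have uu: "cinner (\<iota> (create u)) (\<iota> (create u)) = complex_of_real (2 * c) * inner_fun u u"
    using cinner_power[of u 1 u] by (simp add: moment_def)
  have "(norm (\<iota> (create u)))\<^sup>2 = norm (cinner (\<iota> (create u)) (\<iota> (create u) + V y))"
    by (simp add: cinner_add_right y(2) cinner_self_norm norm_power)
  also have "\<dots> \<le> norm (\<iota> (create u)) * norm (\<iota> (create u) + V y)" by (rule cauchy_schwarz)
  finally have "norm (\<iota> (create u)) \<le> norm (\<iota> (create u) + V y)"
    by (cases "norm (\<iota> (create u)) = 0") (auto simp: power2_eq_square)
  then have "norm (\<iota> (create u)) < e" using less by simp
  then have "(norm (\<iota> (create u)))\<^sup>2 < e\<^sup>2" by (intro power_strict_mono) auto
  also have "e\<^sup>2 = 2 * c * \<epsilon>" using c_pos \<open>\<epsilon> > 0\<close> by (simp add: e_def)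
  also have "(norm (\<iota> (create u)))\<^sup>2 = Re (cinner (\<iota> (create u)) (\<iota> (create u)))"
    by (simp add: cinner_self_norm)
  also have "\<dots> = 2 * c * Re (inner_fun u u)" by (simp add: uu)
  finally show ?thesis using c_pos unfolding u_def by auto
qed

end

section \<open>Moment preserving operators\<close>

definition nsq :: "'d::finite L2Linf \<Rightarrow> real" where
  "nsq f = (\<integral>s. (norm (rep_L2Linf f s))\<^sup>2 \<partial>lborel)"

lemma inner_fun_nsq: "inner_fun f f = of_real (nsq f)"
  by (simp add: nsq_def inner_fun_self)

lemma nsq_eq_0: "nsq f = 0 \<Longrightarrow> f = 0"
  by (rule inner_fun_self_eq_0) (simp add: inner_fun_nsq)

lemma nsq_nonneg: "nsq f \<ge> 0"
  by (simp add: nsq_def)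

lemma norm_sq_add_le: "(norm (a + b :: complex))\<^sup>2 \<le> 2 * (norm a)\<^sup>2 + 2 * (norm b)\<^sup>2"
proof -
  have "(norm (a + b))\<^sup>2 \<le> (norm a + norm b)\<^sup>2" by (intro power_mono norm_triangle_ineq) auto
  also have "\<dots> \<le> 2 * (norm a)\<^sup>2 + 2 * (norm b)\<^sup>2"
    using sum_squares_bound[of "norm a" "norm b"] by (simp add: power2_sum)
  finally show ?thesis .
qed

lemma nsq_mono:
  assumes "AE s in lborel. norm (rep_L2Linf f s) \<le> norm (rep_L2Linf g s)"
  shows "nsq f \<le> nsq g"
  unfolding nsq_def using assms
  by (intro integral_mono_AE rep_integrable_sq) (auto elim!: eventually_mono intro: power_mono)

lemma nsq_add_le: "nsq (f + g) \<le> 2 * nsq f + 2 * nsq g"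
proof -
  have "nsq (f + g) \<le> (\<integral>s. 2 * (norm (rep_L2Linf f s))\<^sup>2 + 2 * (norm (rep_L2Linf g s))\<^sup>2 \<partial>lborel)"
    unfolding nsq_def
  proof (rule integral_mono_AE)
    show "AE s in lborel. (norm (rep_L2Linf (f + g) s))\<^sup>2
        \<le> 2 * (norm (rep_L2Linf f s))\<^sup>2 + 2 * (norm (rep_L2Linf g s))\<^sup>2"
      using rep_plus[of f g] by eventually_elim (simp add: norm_sq_add_le)
  qed (intro rep_integrable_sq Bochner_Integration.integrable_add integrable_mult_right)+
  also have "\<dots> = 2 * nsq f + 2 * nsq g"
    unfolding nsq_def
    by (subst Bochner_Integration.integral_add) (simp_all add: rep_integrable_sq)
  finally show ?thesis .
qed

lemma nsq_minus_commute: "nsq (f - g) = nsq (g - f)"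
proof -
  have "AE s in lborel. norm (rep_L2Linf (f - g) s) = norm (rep_L2Linf (g - f) s)"
    using rep_minus[of f g] rep_minus[of g f] by eventually_elim (simp add: norm_minus_commute)
  then show ?thesis by (intro antisym nsq_mono) (auto elim: eventually_mono)
qed

lemma nsq_triangle_le: "nsq (f - h) \<le> 2 * nsq (f - g) + 2 * nsq (g - h)"
  using nsq_add_le[of "f - g" "g - h"] by simp

text \<open>Inclusion-exclusion for the symmetric trilinear product; 6 counts the arrangements of
  three distinct factors.\<close>

lemma cube_polarization:
  fixes a b c y :: "'d::finite L2Linf"
  shows "6 * inner_fun (a * b * c) y =
    inner_fun ((a + b + c) * (a + b + c) * (a + b + c)) y - inner_fun ((a + b) * (a + b) * (a + b)) y
    - inner_fun ((b + c) * (b + c) * (b + c)) y - inner_fun ((a + c) * (a + c) * (a + c)) y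
    + inner_fun (a * a * a) y + inner_fun (b * b * b) y + inner_fun (c * c * c) y"
  by (simp add: algebra_simps inner_fun_add_left)

lemma square_polarization:
  fixes a b y :: "'d::finite L2Linf"
  shows "2 * inner_fun (a * b) y =
    inner_fun ((a + b) * (a + b)) y - inner_fun (a * a) y - inner_fun (b * b) y"
  by (simp add: algebra_simps inner_fun_add_left)

section \<open>Indicators and phase factors\<close>

definition ind :: "(real ^ 'd) set \<Rightarrow> 'd::finite L2Linf" where
  "ind E = abs_L2Linf (indicator E)"

lemma indicator_L2Linf_fun:
  assumes "E \<in> sets borel" "emeasure lborel E < \<infinity>"
  shows "(indicator E :: real ^ 'd::finite \<Rightarrow> complex) \<in> L2Linf_fun"
proof -
  have "integrable lborel (\<lambda>s. (norm (indicator E s :: complex))\<^sup>2)"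
  proof -
    have "(\<lambda>s. (norm (indicator E s :: complex))\<^sup>2) = indicator E"
      by (rule ext) (simp add: indicator_def)
    moreover have "integrable lborel (indicator E :: _ \<Rightarrow> real)"
      using assms by (intro integrable_real_indicator) auto
    ultimately show ?thesis by simp
  qed
  moreover have "AE s in lborel. norm (indicator E s :: complex) \<le> 1"
    by (simp add: indicator_def)
  moreover have "(indicator E :: _ \<Rightarrow> complex) \<in> borel_measurable lborel" using assms by simp
  ultimately show ?thesis unfolding L2Linf_fun_iff by blast
qed

lemma rep_ind:
  assumes "E \<in> sets borel" "emeasure lborel E < \<infinity>"
  shows "AE s in lborel. rep_L2Linf (ind E) s = indicator E s"
  unfolding ind_def by (rule rep_abs_L2Linf[OF indicator_L2Linf_fun[OF assms]])

lemma conj_ind: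
  assumes "E \<in> sets borel" "emeasure lborel E < \<infinity>"
  shows "conj_fun (ind E) = ind E"
  unfolding L2Linf_eq_iff using rep_conj[of "ind E"] rep_ind[OF assms]
  by eventually_elim (simp add: indicator_def)

lemma ind_times_ind:
  assumes "E \<in> sets borel" "emeasure lborel E < \<infinity>" "F \<in> sets borel" "emeasure lborel F < \<infinity>" "E \<subseteq> F"
  shows "ind E * ind F = ind E"
  unfolding L2Linf_eq_iff using rep_times[of "ind E" "ind F"] rep_ind[OF assms(1,2)] rep_ind[OF assms(3,4)]
  by eventually_elim (use assms(5) in \<open>auto simp: indicator_def\<close>)

lemma L2Linf_fun_bounded_mult:
  assumes f: "f \<in> L2Linf_fun" and u: "u \<in> borel_measurable borel" "AE s in lborel. norm (u s) \<le> 1"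
  shows "(\<lambda>s. u s * f s) \<in> L2Linf_fun"
proof -
  from f obtain C where C: "AE s in lborel. norm (f s) \<le> C"
    and i: "integrable lborel (\<lambda>s. (norm (f s))\<^sup>2)" and [measurable]: "f \<in> borel_measurable borel"
    by (auto simp: L2Linf_fun_iff)
  note [measurable] = u(1)
  have le: "AE s in lborel. norm (u s * f s) \<le> norm (f s)"
    using u(2) by eventually_elim (simp add: norm_mult mult_left_le_one_le)
  have "AE s in lborel. norm (u s * f s) \<le> C"
    using le C by eventually_elim simp
  moreover have "integrable lborel (\<lambda>s. (norm (u s * f s))\<^sup>2)"
    by (rule Bochner_Integration.integrable_bound[OF i])
      (use le in \<open>auto elim!: eventually_mono intro!: power_mono\<close>)
  ultimately show ?thesis unfolding L2Linf_fun_iff by auto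
qed

text \<open>\<open>\<alpha>\<close> is an arbitrary function, so measurability of e^{-i alpha} h is
  not given. It is obtained as the conjugate of T a, where S a = conj(h); an
  \<open>S\<close>-preimage of this function is a \<open>T\<close>-preimage of
  \<open>h\<close>.\<close>

lemma surj_phase:
  assumes ph: "\<And>f. is_phase_mult \<alpha> (S f) (T f)" and "surj S"
  shows "surj T"
proof -
  have "\<exists>b. T b = h" for h
  proof -
    obtain a where a: "S a = conj_fun h" using \<open>surj S\<close> by (metis surjD)
    obtain b where b: "S b = conj_fun (T a)" using \<open>surj S\<close> by (metis surjD)
    have "T b = h"
      unfolding L2Linf_eq_iff
      using ph[of a, unfolded is_phase_mult_eq a] ph[of b, unfolded is_phase_mult_eq b]
        rep_conj[of h] rep_conj[of "T a"]
    proof eventually_elim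
      case (elim s)
      have "exp (\<i> * complex_of_real (\<alpha> s)) * cnj (exp (\<i> * complex_of_real (\<alpha> s))) = 1"
        by (simp add: exp_cnj flip: exp_add)
      then show ?case using elim by (simp flip: mult.assoc)
    qed
    then show ?thesis by blast
  qed
  then show ?thesis by (metis surjI)
qed

lemma is_phase_mult_uminus: "is_phase_mult \<alpha> f g \<Longrightarrow> is_phase_mult (\<lambda>s. - \<alpha> s) g f"
  unfolding is_phase_mult_eq by (erule eventually_mono) (simp flip: mult.assoc exp_add)

text \<open>A multiplicative map compatible with conjugation carries \<open>hpow\<close> to
  \<open>hpow\<close>, and in conj(T f) T g the phase cancels pointwise.\<close>

lemma moment_phase:
  assumes "star_endomorphism S" and ph: "\<And>f. is_phase_mult \<alpha> (S f) (T f)"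
  shows "moment (T f) (T g) k = moment f g k"
proof -
  have S: "S (x * y) = S x * S y" "conj_fun (S x) = S (conj_fun x)"
    "inner_fun (S x) (S y) = inner_fun x y" for x y
    using assms(1) by (simp_all add: star_endomorphism_def)
  have "hpow (S f) (S g) k = S (hpow f g k)"
    by (induction k) (simp_all add: hpow_Suc S)
  then have "moment f g k = moment (S f) (S g) k" by (simp add: moment_def S)
  also have "\<dots> = moment (T f) (T g) k"
    unfolding moment_def inner_fun_eq
  proof (rule integral_cong_AE)
    show "AE s in lborel. cnj (rep_L2Linf (S f) s) * rep_L2Linf (hpow (S f) (S g) k) s =
        cnj (rep_L2Linf (T f) s) * rep_L2Linf (hpow (T f) (T g) k) s"
      using rep_hpow[of "S f" "S g" k] rep_hpow[of "T f" "T g" k]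
        ph[of f, unfolded is_phase_mult_eq] ph[of g, unfolded is_phase_mult_eq]
    proof eventually_elim
      case (elim s)
      let ?e = "exp (\<i> * complex_of_real (\<alpha> s))"
      have e: "cnj ?e * ?e = 1" by (simp add: exp_cnj flip: exp_add)
      have "cnj (?e * a) * (?e * b) = cnj a * b" for a b
      proof -
        have "cnj (?e * a) * (?e * b) = (cnj ?e * ?e) * (cnj a * b)" by (simp only: complex_cnj_mult ac_simps)
        then show ?thesis by (simp only: e mult_1)
      qed
      then have *: "cnj (rep_L2Linf (T f) s) * rep_L2Linf (T g) s = cnj (rep_L2Linf (S f) s) * rep_L2Linf (S g) s"
        using elim by simp
      have "cnj a * ((cnj a * b) ^ k * b) = (cnj a * b) ^ Suc k" for a b
        by (simp add: ac_simps)
      with * show ?case unfolding elim(1,2) by simp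
    qed
  qed simp_all
  finally show ?thesis by simp
qed

section \<open>Polarised moments and the ternary identity\<close>

locale moment_preserving =
  fixes T :: "'d::finite L2Linf \<Rightarrow> 'd L2Linf"
  assumes linear: "clinear T" and moment: "moment (T f) (T g) k = moment f g k"
begin

lemma inner_T: "inner_fun (T f) (T g) = inner_fun f g"
  using moment[of f g 0] by (simp add: moment_def)

lemma nsq_T: "nsq (T f) = nsq f"
  using inner_T[of f f] by (simp add: inner_fun_nsq)

text \<open>The moment of order two, index 1, is the inner product of two squares. Each argument is
  polarised separately, and additivity of \<open>T\<close> lets the images be polarised in
  parallel.\<close>

lemma inner_T2: "inner_fun (T a * T b) (T c * T d) = inner_fun (a * b) (c * d)"
proof -
  have diag: "inner_fun (T f * T f) (T g * T g) = inner_fun (f * f) (g * g)" for f g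
    using moment[of f g 1] by (simp add: moment_def hpow_Suc mult.assoc inner_fun_conj_times_right)
  have left: "inner_fun (T a * T b) (T g * T g) = inner_fun (a * b) (g * g)" for a b g
  proof -
    have "2 * inner_fun (T a * T b) (T g * T g) = 2 * inner_fun (a * b) (g * g)"
      by (simp only: square_polarization diag clinear_add[OF linear, symmetric])
    then show ?thesis by simp
  qed
  then have "inner_fun (T g * T g) (T a * T b) = inner_fun (g * g) (a * b)" for a b g
    by (metis inner_fun_commute)
  then have "2 * inner_fun (T a * T b) (T c * T d) = 2 * inner_fun (a * b) (c * d)"
    by (simp only: square_polarization clinear_add[OF linear, symmetric])
  then show ?thesis by simp
qed

lemma inner_T3: "inner_fun (T a * T b * T c) (T d * T e * T f) = inner_fun (a * b * c) (d * e * f)"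
proof -
  have diag: "inner_fun (T f * T f * T f) (T g * T g * T g) = inner_fun (f * f * f) (g * g * g)" for f g
  proof -
    have "moment x y 2 = inner_fun (x * x * x) (y * y * y)" for x y :: "'d L2Linf"
    proof -
      have "moment x y 2 = inner_fun x (conj_fun x * (conj_fun x * (y * y * y)))"
        by (simp add: moment_def hpow_Suc numeral_2_eq_2 ac_simps)
      then show ?thesis by (simp only: inner_fun_conj_times_right mult.assoc)
    qed
    then show ?thesis using moment[of f g 2] by simp
  qed
  have left: "inner_fun (T a * T b * T c) (T g * T g * T g) = inner_fun (a * b * c) (g * g * g)" for a b c g
  proof -
    have "6 * inner_fun (T a * T b * T c) (T g * T g * T g) = 6 * inner_fun (a * b * c) (g * g * g)"
      by (simp only: cube_polarization diag clinear_add[OF linear, symmetric])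
    then show ?thesis by simp
  qed
  then have "inner_fun (T g * T g * T g) (T a * T b * T c) = inner_fun (g * g * g) (a * b * c)" for a b c g
    by (metis inner_fun_commute)
  then have "6 * inner_fun (T a * T b * T c) (T d * T e * T f) = 6 * inner_fun (a * b * c) (d * e * f)"
    by (simp only: cube_polarization clinear_add[OF linear, symmetric])
  then show ?thesis by simp
qed

text \<open>All inner products in the expansion of \<open>\<parallel>T (f g\<^sup>* h) - T f (T g)\<^sup>* T h\<parallel>\<^sup>2\<close> are moments of
  order at most three.\<close>

lemma ternary: "T (f * conj_fun g * h) = T f * conj_fun (T g) * T h"
proof -
  let ?a = "f * conj_fun g * h" and ?b = "T f * conj_fun (T g) * T h"
  have ab: "inner_fun (T ?a) ?b = inner_fun ?a ?a"
  proof -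
    have "inner_fun (T ?a) ?b = inner_fun (T ?a) (conj_fun (T g) * (T f * T h))" by (simp add: ac_simps)
    \<comment> \<open>Once the conjugated factor has moved to the left, each side is a product of
      two images, so order two suffices here.\<close>
    also have "\<dots> = inner_fun (g * ?a) (f * h)"
      unfolding inner_fun_conj_times_right by (rule inner_T2)
    also have "\<dots> = inner_fun ?a (conj_fun g * (f * h))" by (simp only: inner_fun_conj_times_right)
    finally show ?thesis by (simp add: ac_simps)
  qed
  \<comment> \<open>Conjugating one factor does not change the modulus; this brings
    \<open>?b\<close> within reach of \<open>inner_T3\<close>.\<close>
  have abs: "inner_fun (x * conj_fun y * z) (x * conj_fun y * z) = inner_fun (x * y * z) (x * y * z)"
    for x y z :: "'d L2Linf"
  proof -
    have "inner_fun (x * conj_fun y * z) (x * conj_fun y * z) =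
        inner_fun (conj_fun y * (x * z)) (conj_fun y * (x * z))" by (simp add: ac_simps)
    also have "\<dots> = inner_fun (y * (x * z)) (y * (x * z))"
      unfolding inner_fun_conj_times_left mult.left_commute[of y "conj_fun y"] inner_fun_conj_times_right ..
    finally show ?thesis by (simp add: ac_simps)
  qed
  have "inner_fun ?b (T ?a) = inner_fun ?a ?a"
    using ab by (metis inner_fun_commute)
  moreover have "inner_fun ?b ?b = inner_fun ?a ?a" by (simp only: abs inner_T3)
  ultimately have "inner_fun (T ?a - ?b) (T ?a - ?b) = 0"
    by (simp add: inner_fun_minus_left inner_fun_minus_right ab inner_T)
  then show ?thesis by (metis inner_fun_self_eq_0 eq_iff_diff_eq_0)
qed

text \<open>An indicator e satisfies e = e conj(e) e, and \<open>ternary\<close> carries this over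
  to its image, whose values solve z = z |z|^2.\<close>

lemma T_ind_values:
  assumes "E \<in> sets borel" "emeasure lborel E < \<infinity>"
  shows "AE s in lborel. rep_L2Linf (T (ind E)) s = 0 \<or> norm (rep_L2Linf (T (ind E)) s) = 1"
proof -
  let ?u = "T (ind E)"
  have "?u = ?u * conj_fun ?u * ?u"
    using ternary[of "ind E" "ind E" "ind E"] ind_times_ind[OF assms assms] by (simp add: conj_ind[OF assms])
  then have "AE s in lborel. rep_L2Linf ?u s = rep_L2Linf (?u * conj_fun ?u * ?u) s" by simp
  then show ?thesis
    using rep_times[of "?u * conj_fun ?u" ?u] rep_times[of ?u "conj_fun ?u"] rep_conj[of ?u]
  proof eventually_elim
    case (elim s)
    define z where "z = rep_L2Linf ?u s"
    have "z = z * cnj z * z" using elim by (simp add: z_def)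
    then have "z * (z * cnj z - 1) = 0" by (simp add: right_diff_distrib mult.assoc mult.commute[of "cnj z"])
    then have "z * (of_real ((norm z)\<^sup>2) - 1) = 0" by (simp only: complex_norm_square)
    then have "z = 0 \<or> (norm z)\<^sup>2 = 1"
      by (metis eq_iff_diff_eq_0 mult_eq_0_iff of_real_eq_1_iff)
    moreover have "norm z \<noteq> - 1" using norm_ge_zero[of z] by linarith
    ultimately show ?case unfolding z_def[symmetric] by (auto simp: power2_eq_1_iff)
  qed
qed

lemma T_mult_ind:
  assumes "E \<in> sets borel" "emeasure lborel E < \<infinity>"
  shows "T (f * ind E) = T f * conj_fun (T (ind E)) * T (ind E)"
  using ternary[of f "ind E" "ind E"] ind_times_ind[OF assms assms] by (simp add: conj_ind[OF assms] mult.assoc)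

end

section \<open>Gluing the phase from the images of balls\<close>

context moment_preserving
begin

definition ball_indicator :: "nat \<Rightarrow> 'd L2Linf" where
  "ball_indicator n = ind (cball 0 (real n))"

definition phase_at :: "nat \<Rightarrow> real ^ 'd \<Rightarrow> complex" where
  "phase_at n = rep_L2Linf (T (ball_indicator n))"

lemma ball_sets: "cball (0 :: real ^ 'd) (real n) \<in> sets borel" "emeasure lborel (cball (0 :: real ^ 'd) (real n)) < \<infinity>"
  using emeasure_bounded_finite[OF bounded_cball] by (simp_all add: less_top)

lemma phase_at_values: "AE s in lborel. \<forall>n. phase_at n s = 0 \<or> norm (phase_at n s) = 1"
  unfolding AE_all_countable phase_at_def ball_indicator_def using T_ind_values[OF ball_sets] by blast

text \<open>For nested balls chi_n chi_n chi_m = chi_n, so \<open>ternary\<close> gives |u_n|^2 u_m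
  = u_n for the images, and |u_n| = 1 wherever u_n is nonzero.\<close>

lemma phase_at_stable: "AE s in lborel. \<forall>n m. n \<le> m \<longrightarrow> phase_at n s \<noteq> 0 \<longrightarrow> phase_at m s = phase_at n s"
  unfolding AE_all_countable
proof (intro allI)
  fix n m :: nat
  show "AE s in lborel. n \<le> m \<longrightarrow> phase_at n s \<noteq> 0 \<longrightarrow> phase_at m s = phase_at n s"
  proof (cases "n \<le> m")
    case True
    let ?u = "T (ball_indicator n)" and ?v = "T (ball_indicator m)"
    have idem: "ball_indicator n * ball_indicator n = ball_indicator n" and mult: "ball_indicator n * ball_indicator m = ball_indicator n"
      unfolding ball_indicator_def using True by (intro ind_times_ind ball_sets; auto)+
    have conj: "conj_fun (ball_indicator n) = ball_indicator n"
      unfolding ball_indicator_def by (intro conj_ind ball_sets)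
    have "?u * conj_fun ?u * ?v = ?u"
      using ternary[of "ball_indicator n" "ball_indicator n" "ball_indicator m"] by (simp add: conj idem mult)
    then have "AE s in lborel. rep_L2Linf (?u * conj_fun ?u * ?v) s = phase_at n s" by (simp add: phase_at_def)
    then show ?thesis
      using rep_times[of "?u * conj_fun ?u" ?v] rep_times[of ?u "conj_fun ?u"] rep_conj[of ?u] phase_at_values
    proof eventually_elim
      case (elim s)
      show ?case
      proof (intro impI)
        assume nz: "phase_at n s \<noteq> 0"
        have "phase_at n s * cnj (phase_at n s) = of_real ((norm (phase_at n s))\<^sup>2)"
          by (simp only: complex_norm_square)
        also have "norm (phase_at n s) = 1" using elim nz by blast
        finally have "phase_at n s * cnj (phase_at n s) = 1" by simp
        then show "phase_at m s = phase_at n s"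
          using elim unfolding phase_at_def[symmetric] by (metis mult_1)
      qed
    qed
  qed simp
qed

lemma rep_T_mult_ball: "AE s in lborel. \<forall>n. rep_L2Linf (T (f * ball_indicator n)) s =
    rep_L2Linf (T f) s * cnj (phase_at n s) * phase_at n s"
  unfolding AE_all_countable
proof
  fix n
  let ?u = "T (ball_indicator n)"
  have "T (f * ball_indicator n) = T f * conj_fun ?u * ?u"
    unfolding ball_indicator_def by (rule T_mult_ind[OF ball_sets])
  then show "AE s in lborel. rep_L2Linf (T (f * ball_indicator n)) s =
      rep_L2Linf (T f) s * cnj (phase_at n s) * phase_at n s"
    using rep_times[of "T f * conj_fun ?u" ?u] rep_times[of "T f" "conj_fun ?u"] rep_conj[of ?u]
    unfolding phase_at_def by auto
qed

text \<open>On \<open>Z\<close> the images of all restrictions of \<open>f\<close> to balls vanish,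
  so there T f equals the image of a tail of \<open>f\<close>. Its mass is at most the L^2 mass of
  that tail, which tends to 0.\<close>

lemma phase_at_support:
  "AE s in lborel. (\<forall>n. phase_at n s = 0) \<longrightarrow> rep_L2Linf (T f) s = 0"
proof -
  define Z where "Z = {s. \<forall>n. phase_at n s = 0}"
  have [measurable]: "phase_at n \<in> borel_measurable borel" for n by (simp add: phase_at_def)
  have Z: "Z \<in> sets borel" unfolding Z_def by measurable
  define q where "q s = (norm (rep_L2Linf f s))\<^sup>2" for s
  define p where "p s = indicator Z s * (norm (rep_L2Linf (T f) s))\<^sup>2" for s
  have q: "integrable lborel q" unfolding q_def by (rule rep_integrable_sq)
  have [measurable]: "q \<in> borel_measurable borel" unfolding q_def by measurable
  have [measurable]: "p \<in> borel_measurable borel" unfolding p_def using Z by measurable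
  have p: "integrable lborel p"
    by (rule Bochner_Integration.integrable_bound[OF rep_integrable_sq[of "T f"]])
      (simp_all add: p_def indicator_def)
  have le: "integral\<^sup>L lborel p \<le> (\<integral>s. q s * indicator (- cball 0 (real n)) s \<partial>lborel)" for n
  proof -
    let ?x = "f - f * ball_indicator n"
    have "integral\<^sup>L lborel p \<le> nsq (T ?x)"
      unfolding nsq_def
    proof (rule integral_mono_AE[OF p rep_integrable_sq])
      have "T ?x = T f - T (f * ball_indicator n)" by (rule clinear_diff[OF linear])
      then have "AE s in lborel. rep_L2Linf (T ?x) s = rep_L2Linf (T f) s - rep_L2Linf (T (f * ball_indicator n)) s"
        using rep_minus[of "T f" "T (f * ball_indicator n)"] by simp
      then show "AE s in lborel. p s \<le> (norm (rep_L2Linf (T ?x) s))\<^sup>2"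
        using rep_T_mult_ball[of f]
      proof eventually_elim
        case (elim s)
        then show ?case by (cases "s \<in> Z") (simp_all add: p_def Z_def)
      qed
    qed
    also have "\<dots> = nsq ?x" by (rule nsq_T)
    also have "\<dots> = (\<integral>s. q s * indicator (- cball 0 (real n)) s \<partial>lborel)"
      unfolding nsq_def
    proof (rule integral_cong_AE)
      show "AE s in lborel. (norm (rep_L2Linf ?x s))\<^sup>2 = q s * indicator (- cball 0 (real n)) s"
        using rep_minus[of f "f * ball_indicator n"] rep_times[of f "ball_indicator n"] rep_ind[OF ball_sets[of n]]
        by eventually_elim (simp add: q_def ball_indicator_def indicator_def)
    qed measurable
    finally show ?thesis .
  qed
  have "(\<lambda>n. \<integral>s. q s * indicator (- cball 0 (real n)) s \<partial>lborel) \<longlonglongrightarrow> (\<integral>s. 0 \<partial>(lborel :: (real ^ 'd) measure))"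
  proof (rule integral_dominated_convergence[where w = q])
    show "AE s in lborel. (\<lambda>n. q s * indicator (- cball 0 (real n)) s) \<longlonglongrightarrow> 0"
    proof (rule AE_I2)
      fix s :: "real ^ 'd"
      obtain N :: nat where N: "norm s \<le> real N" using real_arch_simple by blast
      show "(\<lambda>n. q s * indicator (- cball 0 (real n)) s) \<longlonglongrightarrow> 0"
      proof (rule tendsto_eventually[OF eventually_sequentiallyI])
        fix n assume "N \<le> n"
        then have "norm s \<le> real n" using N by linarith
        then show "q s * indicator (- cball 0 (real n)) s = 0" by (simp add: indicator_def)
      qed
    qed
    show "AE s in lborel. norm (q s * indicator (- cball 0 (real n)) s) \<le> q s" for n
      by (simp add: q_def indicator_def)
  qed (use q in \<open>auto\<close>)
  then have "integral\<^sup>L lborel p \<le> 0"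
    using le by (intro LIMSEQ_le_const[of _ 0]) auto
  moreover have "integral\<^sup>L lborel p \<ge> 0" by (simp add: p_def)
  ultimately have "AE s in lborel. p s = 0"
    using integral_nonneg_eq_0_iff_AE[OF p] by (simp add: p_def)
  then show ?thesis by eventually_elim (auto simp: p_def Z_def)
qed

text \<open>Almost everywhere \<open>phase_at n s\<close> is eventually constant in
  \<open>n\<close>, and \<open>lim\<close> picks the eventual value. Where that is 0 the value 1
  keeps the function unimodular.\<close>

definition phase :: "real ^ 'd \<Rightarrow> complex" where
  "phase s = (if lim (\<lambda>n. phase_at n s) = 0 then 1 else lim (\<lambda>n. phase_at n s))"

lemma phase_measurable [measurable]: "phase \<in> borel_measurable borel"
proof -
  have [measurable]: "phase_at n \<in> borel_measurable borel" for n by (simp add: phase_at_def)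
  have [measurable]: "(\<lambda>s. lim (\<lambda>n. phase_at n s)) \<in> borel_measurable borel"
    by (rule borel_measurable_lim_metric) measurable
  show ?thesis unfolding phase_def by measurable
qed

lemma phase_eq: "AE s in lborel. norm (phase s) = 1 \<and> (\<forall>n. phase_at n s \<noteq> 0 \<longrightarrow> phase_at n s = phase s)"
  using phase_at_values phase_at_stable
proof eventually_elim
  case (elim s)
  show ?case
  proof (cases "\<forall>n. phase_at n s = 0")
    case True
    then show ?thesis by (simp add: phase_def)
  next
    case False
    then obtain N where N: "phase_at N s \<noteq> 0" by blast
    have ph: "phase s = phase_at n s" if "phase_at n s \<noteq> 0" for n
    proof -
      have "(\<lambda>k. phase_at k s) \<longlonglongrightarrow> phase_at n s"
        by (rule tendsto_eventually[OF eventually_sequentiallyI[of n]]) (use elim that in blast)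
      then have "lim (\<lambda>k. phase_at k s) = phase_at n s" by (rule limI)
      then show ?thesis using that by (simp add: phase_def)
    qed
    then show ?thesis using elim(1) N by metis
  qed
qed

definition untwisted :: "'d L2Linf \<Rightarrow> 'd L2Linf" where
  "untwisted f = abs_L2Linf (\<lambda>s. cnj (phase s) * rep_L2Linf (T f) s)"

lemma rep_untwisted: "AE s in lborel. rep_L2Linf (untwisted f) s = cnj (phase s) * rep_L2Linf (T f) s"
  unfolding untwisted_def
proof (rule rep_abs_L2Linf, rule L2Linf_fun_bounded_mult[OF rep_L2Linf])
  show "(\<lambda>s. cnj (phase s)) \<in> borel_measurable borel" by measurable
  show "AE s in lborel. norm (cnj (phase s)) \<le> 1" using phase_eq by eventually_elim simp
qed

lemma rep_T: "AE s in lborel. rep_L2Linf (T f) s = phase s * rep_L2Linf (untwisted f) s"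
  using rep_untwisted[of f] phase_eq
proof eventually_elim
  case (elim s)
  have "phase s * cnj (phase s) = of_real ((norm (phase s))\<^sup>2)" by (simp only: complex_norm_square)
  then show ?case using elim by (simp flip: mult.assoc)
qed

lemma star_endomorphism_untwisted: "star_endomorphism untwisted"
  unfolding star_endomorphism_def
proof (intro conjI allI)
  show "clinear untwisted"
  proof (rule clinearI)
    show "untwisted (f + g) = untwisted f + untwisted g" for f g
      unfolding L2Linf_eq_iff
      using rep_untwisted[of f] rep_untwisted[of g] rep_untwisted[of "f + g"] rep_plus[of "T f" "T g"]
        rep_plus[of "untwisted f" "untwisted g"]
      by eventually_elim (simp add: clinear_add[OF linear] algebra_simps)
    show "untwisted (z *\<^sub>C f) = z *\<^sub>C untwisted f" for z f
      unfolding L2Linf_eq_iff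
      using rep_untwisted[of f] rep_untwisted[of "z *\<^sub>C f"] rep_scale[of z "T f"] rep_scale[of z "untwisted f"]
      by eventually_elim (simp add: clinear_scale[OF linear])
  qed
next
  fix f g
  have "inner_fun (untwisted f) (untwisted g) = inner_fun (T f) (T g)"
    unfolding inner_fun_eq
  proof (rule integral_cong_AE)
    show "AE s in lborel. cnj (rep_L2Linf (untwisted f) s) * rep_L2Linf (untwisted g) s =
        cnj (rep_L2Linf (T f) s) * rep_L2Linf (T g) s"
      using rep_untwisted[of f] rep_untwisted[of g] phase_eq
    proof eventually_elim
      case (elim s)
      have "phase s * cnj (phase s) = of_real ((norm (phase s))\<^sup>2)" by (simp only: complex_norm_square)
      then have "phase s * cnj (phase s) = 1" using elim by simp
      moreover have "cnj (cnj a * x) * (cnj a * y) = (a * cnj a) * (cnj x * y)" for a x y by simp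
      ultimately show ?case by (simp only: elim mult_1)
    qed
  qed simp_all
  then show "inner_fun (untwisted f) (untwisted g) = inner_fun f g" by (simp add: inner_T)
next
  fix f g
  \<comment> \<open>T (f g chi_n) is now known in two forms, this one and
    \<open>rep_T_mult_ball\<close>. Where \<open>phase_at n\<close> is nonzero it equals
    \<open>phase\<close>, and comparison gives multiplicativity; elsewhere
    \<open>phase_at_support\<close> applies.\<close>
  have "T (f * g * ball_indicator n) = T f * conj_fun (T (ball_indicator n)) * T g" for n
    using ternary[of f "ball_indicator n" g]
    by (simp add: ball_indicator_def conj_ind[OF ball_sets] mult.assoc mult.commute[of g])
  moreover have "AE s in lborel. rep_L2Linf (T f * conj_fun (T (ball_indicator n)) * T g) s =
      rep_L2Linf (T f) s * cnj (phase_at n s) * rep_L2Linf (T g) s" for n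
    using rep_times[of "T f * conj_fun (T (ball_indicator n))" "T g"] rep_times[of "T f" "conj_fun (T (ball_indicator n))"]
      rep_conj[of "T (ball_indicator n)"] by eventually_elim (simp add: phase_at_def)
  ultimately have "AE s in lborel. \<forall>n. rep_L2Linf (T (f * g * ball_indicator n)) s =
      rep_L2Linf (T f) s * cnj (phase_at n s) * rep_L2Linf (T g) s"
    unfolding AE_all_countable by simp
  then show "untwisted (f * g) = untwisted f * untwisted g"
    unfolding L2Linf_eq_iff
    using rep_untwisted[of f] rep_untwisted[of g] rep_untwisted[of "f * g"]
      rep_times[of "untwisted f" "untwisted g"] rep_T_mult_ball[of "f * g"] phase_eq
      phase_at_support[of f] phase_at_support[of "f * g"]
  proof eventually_elim
    case (elim s)
    show ?case
    proof (cases "\<forall>n. phase_at n s = 0")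
      case True
      then show ?thesis using elim by simp
    next
      case False
      then obtain n where n: "phase_at n s \<noteq> 0" by blast
      then have ph: "phase_at n s = phase s" using elim by blast
      have "cnj (phase s) * phase s = of_real ((norm (phase s))\<^sup>2)"
        by (simp only: complex_norm_square mult.commute)
      then have 1: "cnj (phase s) * phase s = 1" using elim by simp
      have "rep_L2Linf (T (f * g)) s * (cnj (phase s) * phase s) =
          rep_L2Linf (T f) s * cnj (phase s) * rep_L2Linf (T g) s"
        using elim(1,6) ph by (metis mult.assoc)
      then show ?thesis unfolding 1 by (simp add: elim(2-5))
    qed
  qed
next
  fix f
  \<comment> \<open>With the ball in both outer slots, the conjugation in the middle slot falls on
    \<open>f\<close> itself.\<close>
  have "T (conj_fun f * ball_indicator n) = T (ball_indicator n) * conj_fun (T f) * T (ball_indicator n)" for n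
    using ternary[of "ball_indicator n" f "ball_indicator n"] ind_times_ind[OF ball_sets[of n] ball_sets[of n] order_refl]
    by (simp add: ball_indicator_def mult.assoc mult.commute[of _ "conj_fun f"])
  moreover have "AE s in lborel. rep_L2Linf (T (ball_indicator n) * conj_fun (T f) * T (ball_indicator n)) s =
      phase_at n s * cnj (rep_L2Linf (T f) s) * phase_at n s" for n
    using rep_times[of "T (ball_indicator n) * conj_fun (T f)" "T (ball_indicator n)"]
      rep_times[of "T (ball_indicator n)" "conj_fun (T f)"] rep_conj[of "T f"]
    by eventually_elim (simp add: phase_at_def)
  ultimately have "AE s in lborel. \<forall>n. rep_L2Linf (T (conj_fun f * ball_indicator n)) s =
      phase_at n s * cnj (rep_L2Linf (T f) s) * phase_at n s"
    unfolding AE_all_countable by simp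
  then show "conj_fun (untwisted f) = untwisted (conj_fun f)"
    unfolding L2Linf_eq_iff
    using rep_untwisted[of f] rep_untwisted[of "conj_fun f"]
      rep_conj[of "untwisted f"] rep_T_mult_ball[of "conj_fun f"] phase_eq
      phase_at_support[of f] phase_at_support[of "conj_fun f"]
  proof eventually_elim
    case (elim s)
    show ?case
    proof (cases "\<forall>n. phase_at n s = 0")
      case True
      then show ?thesis using elim by simp
    next
      case False
      then obtain n where n: "phase_at n s \<noteq> 0" by blast
      then have ph: "phase_at n s = phase s" using elim by blast
      have "cnj (phase s) * phase s = of_real ((norm (phase s))\<^sup>2)"
        by (simp only: complex_norm_square mult.commute)
      then have 1: "cnj (phase s) * phase s = 1" using elim by simp
      have "rep_L2Linf (T (conj_fun f)) s * (cnj (phase s) * phase s) =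
          phase s * cnj (rep_L2Linf (T f) s) * phase s"
        using elim(1,5) ph by (metis mult.assoc)
      then have *: "rep_L2Linf (T (conj_fun f)) s = phase s * cnj (rep_L2Linf (T f) s) * phase s"
        unfolding 1 by simp
      have "cnj (phase s) * (phase s * cnj (rep_L2Linf (T f) s) * phase s) =
          (cnj (phase s) * phase s) * (cnj (rep_L2Linf (T f) s) * phase s)" by (simp only: mult.assoc)
      then show ?thesis unfolding elim(3) * 1 by (simp add: elim(2,4))
    qed
  qed
qed

lemma is_phase_mult_untwisted: "is_phase_mult (\<lambda>s. Arg (phase s)) (untwisted f) (T f)"
  unfolding is_phase_mult_eq using rep_T[of f] phase_eq
proof eventually_elim
  case (elim s)
  then have "phase s = exp (\<i> * complex_of_real (Arg (phase s)))"
    using Arg_eq[of "phase s"] by fastforce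
  then show ?case using elim by simp
qed

end

section \<open>Surjectivity\<close>

lemma nn_integral_nsq: "(\<integral>\<^sup>+s. ennreal ((norm (rep_L2Linf f s))\<^sup>2) \<partial>lborel) = ennreal (nsq f)"
  unfolding nsq_def by (rule nn_integral_eq_integral[OF rep_integrable_sq]) simp

lemma zero_of_le_geometric:
  assumes "x \<ge> 0" "\<And>j. x \<le> K * (1 / 8 :: real) ^ j"
  shows "x = 0"
proof -
  have "(\<lambda>j. K * (1 / 8 :: real) ^ j) \<longlonglongrightarrow> K * 0"
    by (intro tendsto_mult tendsto_const LIMSEQ_power_zero) simp
  then have "x \<le> K * 0" using assms(2) by (intro LIMSEQ_le_const) auto
  then show ?thesis using assms(1) by simp
qed

text \<open>Riesz--Fischer for a rapidly converging Cauchy sequence: the bound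
  \<open>2 x \<le> 2\<^sup>j x\<^sup>2 + 2\<^sup>-\<^sup>j\<close> turns summability of the squared increments into absolute
  summability of the increments almost everywhere.\<close>

lemma L2_cauchy_limit:
  fixes f :: "nat \<Rightarrow> 'd::finite L2Linf"
  assumes cauchy: "\<And>j k. j \<le> k \<Longrightarrow> nsq (f k - f j) \<le> (1 / 8) ^ j"
  obtains F where "F \<in> borel_measurable borel"
    "\<And>j. (\<integral>\<^sup>+s. ennreal ((norm (F s - rep_L2Linf (f j) s))\<^sup>2) \<partial>lborel) \<le> ennreal ((1 / 8) ^ j)"
proof -
  define F where "F s = lim (\<lambda>j. rep_L2Linf (f j) s)" for s
  \<comment> \<open>The decay 8^-j pays for the weight 2^j: the integral of \<open>d j\<close> is at
    most 4^-j.\<close>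
  define d where "d j s = 2 ^ j * (norm (rep_L2Linf (f (Suc j)) s - rep_L2Linf (f j) s))\<^sup>2" for j s
  have F [measurable]: "F \<in> borel_measurable borel"
    unfolding F_def by (rule borel_measurable_lim_metric) simp
  have [measurable]: "d j \<in> borel_measurable borel" for j unfolding d_def by measurable
  have diff: "(\<integral>\<^sup>+s. ennreal ((norm (rep_L2Linf (f k) s - rep_L2Linf (f j) s))\<^sup>2) \<partial>lborel) \<le> ennreal ((1 / 8) ^ j)"
    if "j \<le> k" for j k
  proof -
    have "(\<integral>\<^sup>+s. ennreal ((norm (rep_L2Linf (f k) s - rep_L2Linf (f j) s))\<^sup>2) \<partial>lborel) =
        (\<integral>\<^sup>+s. ennreal ((norm (rep_L2Linf (f k - f j) s))\<^sup>2) \<partial>lborel)"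
      using rep_minus[of "f k" "f j"] by (intro nn_integral_cong_AE) (auto elim!: eventually_mono)
    then show ?thesis using cauchy[OF that] by (simp add: nn_integral_nsq ennreal_leI)
  qed
  have "(\<integral>\<^sup>+s. ennreal (d j s) \<partial>lborel) \<le> ennreal ((1 / 4) ^ j)" for j
  proof -
    have "(\<integral>\<^sup>+s. ennreal (d j s) \<partial>lborel) =
        ennreal (2 ^ j) * (\<integral>\<^sup>+s. ennreal ((norm (rep_L2Linf (f (Suc j)) s - rep_L2Linf (f j) s))\<^sup>2) \<partial>lborel)"
      unfolding d_def by (subst nn_integral_cmult[symmetric]) (simp_all add: ennreal_mult)
    also have "\<dots> \<le> ennreal (2 ^ j) * ennreal ((1 / 8) ^ j)"
      by (intro mult_left_mono diff) auto
    also have "\<dots> = ennreal ((1 / 4) ^ j)"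
      by (subst ennreal_mult[symmetric]) (simp_all flip: power_mult_distrib)
    finally show ?thesis .
  qed
  then have "suminf (\<lambda>j. \<integral>\<^sup>+s. ennreal (d j s) \<partial>lborel) \<le> suminf (\<lambda>j. ennreal ((1 / 4) ^ j))"
    by (intro suminf_le summableI)
  also have "\<dots> = ennreal (suminf (\<lambda>j. (1 / 4) ^ j))"
    by (intro suminf_ennreal2 summable_geometric) auto
  also have "\<dots> < \<infinity>" by simp
  finally have "(\<integral>\<^sup>+s. suminf (\<lambda>j. ennreal (d j s)) \<partial>lborel) \<noteq> \<infinity>"
    by (subst nn_integral_suminf) auto
  then have "AE s in lborel. suminf (\<lambda>j. ennreal (d j s)) \<noteq> \<infinity>"
    by (intro nn_integral_PInf_AE) measurable
  then have conv: "AE s in lborel. (\<lambda>j. rep_L2Linf (f j) s) \<longlonglongrightarrow> F s"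
  proof eventually_elim
    case (elim s)
    let ?x = "\<lambda>j. rep_L2Linf (f (Suc j)) s - rep_L2Linf (f j) s"
    have "summable (\<lambda>j. d j s)"
      using elim by (intro summable_suminf_not_top) (simp_all add: d_def)
    then have sum: "summable (\<lambda>j. d j s + (1 / 2) ^ j)"
      by (intro summable_add summable_geometric) auto
    have "norm (?x j) \<le> d j s + (1 / 2) ^ j" for j
    proof -
      define p :: real where "p = 2 ^ j"
      have p: "p > 0" by (simp add: p_def)
      have "2 * norm (?x j) \<le> p * (norm (?x j))\<^sup>2 + 1 / p"
      proof -
        have "0 \<le> (p * norm (?x j) - 1)\<^sup>2 / p" using p by simp
        also have "\<dots> = p * (norm (?x j))\<^sup>2 + 1 / p - 2 * norm (?x j)"
          using p by (simp add: power2_eq_square field_simps)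
        finally show ?thesis by simp
      qed
      then have "norm (?x j) \<le> p * (norm (?x j))\<^sup>2 + 1 / p" using norm_ge_zero[of "?x j"] by linarith
      then show ?thesis by (simp add: d_def p_def power_one_over)
    qed
    then have "summable ?x"
      by (intro summable_comparison_test'[OF sum, of 0]) simp
    then have "convergent (\<lambda>n. sum ?x {..<n})" by (simp only: summable_iff_convergent)
    moreover have "sum ?x {..<n} = rep_L2Linf (f n) s - rep_L2Linf (f 0) s" for n
      by (induction n) simp_all
    ultimately have "convergent (\<lambda>n. rep_L2Linf (f n) s - rep_L2Linf (f 0) s)"
      by (simp only:)
    from convergent_add[OF this convergent_const[of "rep_L2Linf (f 0) s"]]
    have "convergent (\<lambda>n. rep_L2Linf (f n) s)" by simp
    then show ?case unfolding F_def by (simp add: convergent_LIMSEQ_iff)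
  qed
  have "(\<integral>\<^sup>+s. ennreal ((norm (F s - rep_L2Linf (f j) s))\<^sup>2) \<partial>lborel) \<le> ennreal ((1 / 8) ^ j)" for j
  proof -
    \<comment> \<open>Fatou's lemma in \<open>k\<close> turns the Cauchy bound into a bound for the
      distance to the limit.\<close>
    let ?u = "\<lambda>k s. ennreal ((norm (rep_L2Linf (f k) s - rep_L2Linf (f j) s))\<^sup>2)"
    have "(\<integral>\<^sup>+s. ennreal ((norm (F s - rep_L2Linf (f j) s))\<^sup>2) \<partial>lborel) = (\<integral>\<^sup>+s. liminf (\<lambda>k. ?u k s) \<partial>lborel)"
    proof (rule nn_integral_cong_AE)
      show "AE s in lborel. ennreal ((norm (F s - rep_L2Linf (f j) s))\<^sup>2) = liminf (\<lambda>k. ?u k s)"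
        using conv
      proof eventually_elim
        case (elim s)
        have "(\<lambda>k. ?u k s) \<longlonglongrightarrow> ennreal ((norm (F s - rep_L2Linf (f j) s))\<^sup>2)"
          by (intro tendsto_ennrealI tendsto_intros elim)
        then show ?case by (intro lim_imp_Liminf[symmetric]) auto
      qed
    qed
    also have "\<dots> \<le> liminf (\<lambda>k. \<integral>\<^sup>+s. ?u k s \<partial>lborel)"
      by (rule nn_integral_liminf) measurable
    also have "\<dots> \<le> liminf (\<lambda>k. ennreal ((1 / 8) ^ j))"
      by (rule Liminf_mono) (auto simp: eventually_sequentially intro!: exI[of _ j] diff)
    finally show ?thesis by (simp add: Liminf_const)
  qed
  with F show ?thesis by (rule that)
qed

context moment_preserving
begin

lemma dense_imp_surj:
  assumes dense: "\<And>h \<epsilon>. \<epsilon> > 0 \<Longrightarrow> \<exists>f. nsq (T f - h) < \<epsilon>"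
  shows "surj T"
proof -
  have "\<exists>g. T g = h" for h
  proof -
    \<comment> \<open>The quarter compensates the factor 2 of \<open>nsq_triangle_le\<close>: two
      such errors add up to at most 8^-j.\<close>
    have "\<forall>j. \<exists>f. nsq (T f - h) < (1 / 8) ^ j / 4" by (intro allI dense) simp
    then obtain f where f: "\<And>j. nsq (T (f j) - h) < (1 / 8) ^ j / 4" by metis
    have "nsq (f k - f j) \<le> (1 / 8) ^ j" if "j \<le> k" for j k
    proof -
      have "nsq (f k - f j) = nsq (T (f k) - T (f j))"
        using nsq_T[of "f k - f j"] by (simp add: clinear_diff[OF linear])
      also have "\<dots> \<le> 2 * nsq (T (f k) - h) + 2 * nsq (T (f j) - h)"
        using nsq_triangle_le[of "T (f k)" "T (f j)" h] by (simp add: nsq_minus_commute)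
      also have "\<dots> \<le> 2 * ((1 / 8) ^ k / 4) + 2 * ((1 / 8) ^ j / 4)"
        using f[of j] f[of k] by linarith
      also have "(1 / 8 :: real) ^ k \<le> (1 / 8) ^ j" using that by (intro power_decreasing) auto
      finally show ?thesis by simp
    qed
    then obtain F where F [measurable]: "F \<in> borel_measurable borel"
      and lim: "\<And>j. (\<integral>\<^sup>+s. ennreal ((norm (F s - rep_L2Linf (f j) s))\<^sup>2) \<partial>lborel) \<le> ennreal ((1 / 8) ^ j)"
      by (rule L2_cauchy_limit[of f]) blast+
    have close: "nsq x \<le> (1 / 8) ^ j"
      if "AE s in lborel. norm (rep_L2Linf x s) \<le> norm (F s - rep_L2Linf (f j) s)" for x j
    proof -
      have "ennreal (nsq x) \<le> (\<integral>\<^sup>+s. ennreal ((norm (F s - rep_L2Linf (f j) s))\<^sup>2) \<partial>lborel)"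
        unfolding nn_integral_nsq[symmetric] using that
        by (intro nn_integral_mono_AE) (auto elim!: eventually_mono intro!: ennreal_leI power_mono)
      also note lim[of j]
      finally show ?thesis by simp
    qed
    obtain C where C: "C > 0" "AE s in lborel. norm (rep_L2Linf h s) \<le> C" by (rule rep_bounded)
    \<comment> \<open>Bounding both \<open>s\<close> and \<open>F s\<close> by \<open>n\<close> puts
      F chi_E into the algebra, although \<open>F\<close> is so far only a measurable L^2
      limit.\<close>
    define E where "E n = {s \<in> cball 0 (real n). C < norm (F s) \<and> norm (F s) \<le> real n}" for n
    have "AE s in lborel. s \<notin> E n" for n
    proof -
      have E [measurable]: "E n \<in> sets borel" unfolding E_def by measurable
      have "emeasure lborel (E n) \<le> emeasure lborel (cball (0 :: real ^ 'd) (real n))"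
        by (rule emeasure_mono) (auto simp: E_def)
      then have Efin: "emeasure lborel (E n) < \<infinity>" using ball_sets(2)[of n] by (rule le_less_trans)
      define g where "g s = indicator (E n) s * F s" for s
      have g_le: "norm (g s) \<le> real n * norm (indicator (E n) s :: complex)" for s
        by (auto simp: g_def E_def indicator_def)
      have "integrable lborel (\<lambda>s. (norm (g s))\<^sup>2)"
      proof (rule Bochner_Integration.integrable_bound)
        show "integrable lborel (\<lambda>s. (real n)\<^sup>2 * indicator (E n) s :: real)"
          using Efin by (intro integrable_mult_right integrable_real_indicator) auto
        show "AE s in lborel. norm ((norm (g s))\<^sup>2) \<le> norm ((real n)\<^sup>2 * indicator (E n) s :: real)"
          by (intro AE_I2) (auto simp: g_def E_def indicator_def intro!: power_mono)
      qed (simp add: g_def)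
      moreover have "AE s in lborel. norm (g s) \<le> real n"
        by (intro AE_I2) (auto simp: g_def E_def indicator_def)
      moreover have "g \<in> borel_measurable borel" unfolding g_def by measurable
      ultimately have "g \<in> L2Linf_fun" unfolding L2Linf_fun_iff by auto
      define G where "G = abs_L2Linf g"
      have G: "AE s in lborel. rep_L2Linf G s = g s"
        unfolding G_def by (rule rep_abs_L2Linf) fact
      let ?u = "T (ind (E n))"
      have ule: "AE s in lborel. norm (rep_L2Linf ?u s) \<le> 1"
        using T_ind_values[OF E Efin] by eventually_elim auto
      \<comment> \<open>Both sides are L^2 limits of T (f_j chi_E): f_j chi_E tends to
        \<open>G\<close>, and T f_j |u|^2 tends to h |u|^2 because |u| <= 1.\<close>
      have TG: "T G = h * conj_fun ?u * ?u"
      proof -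
        have "nsq (T G - h * conj_fun ?u * ?u) \<le> 4 * (1 / 8) ^ j" for j
        proof -
          have "nsq (T G - T (f j * ind (E n))) = nsq (G - f j * ind (E n))"
            using nsq_T[of "G - f j * ind (E n)"] by (simp add: clinear_diff[OF linear])
          also have "\<dots> \<le> (1 / 8) ^ j"
          proof (rule close)
            show "AE s in lborel. norm (rep_L2Linf (G - f j * ind (E n)) s) \<le> norm (F s - rep_L2Linf (f j) s)"
              using G rep_minus[of G "f j * ind (E n)"] rep_times[of "f j" "ind (E n)"] rep_ind[OF E Efin]
              by eventually_elim (simp add: g_def indicator_def)
          qed
          finally have 1: "nsq (T G - T (f j * ind (E n))) \<le> (1 / 8) ^ j" .
          have "T (f j * ind (E n)) - h * conj_fun ?u * ?u = (T (f j) - h) * conj_fun ?u * ?u"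
            by (simp add: T_mult_ind[OF E Efin] left_diff_distrib)
          also have "nsq \<dots> \<le> nsq (T (f j) - h)"
          proof (rule nsq_mono)
            show "AE s in lborel. norm (rep_L2Linf ((T (f j) - h) * conj_fun ?u * ?u) s) \<le> norm (rep_L2Linf (T (f j) - h) s)"
              using rep_times[of "(T (f j) - h) * conj_fun ?u" ?u] rep_times[of "T (f j) - h" "conj_fun ?u"]
                rep_conj[of ?u] ule
            proof eventually_elim
              case (elim s)
              then show ?case
                by (simp add: norm_mult mult_left_le mult_le_one mult.assoc)
            qed
          qed
          also have "\<dots> \<le> (1 / 8) ^ j / 4" using f[of j] by simp
          finally have 2: "nsq (T (f j * ind (E n)) - h * conj_fun ?u * ?u) \<le> (1 / 8) ^ j / 4" .
          show ?thesis
            using nsq_triangle_le[of "T G" "h * conj_fun ?u * ?u" "T (f j * ind (E n))"] 1 2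
              zero_le_power[of "1 / 8 :: real" j] by linarith
        qed
        then have "nsq (T G - h * conj_fun ?u * ?u) = 0" by (rule zero_of_le_geometric[OF nsq_nonneg])
        then show ?thesis using nsq_eq_0 by fastforce
      qed
      have "nsq G = nsq (h * conj_fun ?u * ?u)" using nsq_T[of G] TG by simp
      also have "\<dots> \<le> nsq (complex_of_real C *\<^sub>C ?u)"
      proof (rule nsq_mono)
        show "AE s in lborel. norm (rep_L2Linf (h * conj_fun ?u * ?u) s) \<le> norm (rep_L2Linf (complex_of_real C *\<^sub>C ?u) s)"
          using rep_times[of "h * conj_fun ?u" ?u] rep_times[of h "conj_fun ?u"]
            rep_conj[of ?u] rep_scale[of "complex_of_real C" ?u] ule C(2)
        proof eventually_elim
          case (elim s)
          have "norm (rep_L2Linf h s) * norm (rep_L2Linf ?u s) \<le> C * 1"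
            using elim C(1) by (intro mult_mono) auto
          then have "norm (rep_L2Linf h s) * norm (rep_L2Linf ?u s) * norm (rep_L2Linf ?u s) \<le> C * norm (rep_L2Linf ?u s)"
            by (intro mult_right_mono) auto
          then show ?case using elim C(1) by (simp add: norm_mult)
        qed
      qed
      also have "\<dots> = C\<^sup>2 * nsq ?u"
      proof -
        have "complex_of_real (nsq (complex_of_real C *\<^sub>C ?u)) = complex_of_real (C\<^sup>2 * nsq ?u)"
          unfolding inner_fun_nsq[symmetric] inner_fun_scale_left inner_fun_scale_right
          by (simp add: inner_fun_nsq power2_eq_square)
        then show ?thesis by (simp only: of_real_eq_iff)
      qed
      also have "nsq ?u = nsq (ind (E n))" by (rule nsq_T)
      finally have le: "nsq G \<le> C\<^sup>2 * nsq (ind (E n))" .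
      \<comment> \<open>\<open>?r\<close> is nonnegative with integral at most 0, hence null; but it
        is strictly positive on \<open>E n\<close>, which must therefore be a null set.\<close>
      let ?r = "\<lambda>s. (norm (rep_L2Linf G s))\<^sup>2 - C\<^sup>2 * (norm (rep_L2Linf (ind (E n)) s))\<^sup>2"
      have r: "integrable lborel ?r"
        by (intro Bochner_Integration.integrable_diff integrable_mult_right rep_integrable_sq)
      have r_eq: "AE s in lborel. ?r s = indicator (E n) s * ((norm (F s))\<^sup>2 - C\<^sup>2)"
        using G rep_ind[OF E Efin] by eventually_elim (simp add: g_def indicator_def)
      have r_pos: "AE s in lborel. 0 \<le> ?r s"
        using r_eq
      proof eventually_elim
        case (elim s)
        have "C\<^sup>2 \<le> (norm (F s))\<^sup>2" if "s \<in> E n" using that C(1) by (intro power_mono) (auto simp: E_def)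
        then show ?case unfolding elim by (simp add: indicator_def)
      qed
      have "integral\<^sup>L lborel ?r = nsq G - C\<^sup>2 * nsq (ind (E n))"
        unfolding nsq_def
        by (subst Bochner_Integration.integral_diff) (simp_all add: rep_integrable_sq)
      then have "integral\<^sup>L lborel ?r \<le> 0" using le by simp
      then have "integral\<^sup>L lborel ?r = 0" using integral_nonneg_AE[OF r_pos] by linarith
      then have "AE s in lborel. ?r s = 0"
        using integral_nonneg_eq_0_iff_AE[OF r r_pos] by simp
      with r_eq show ?thesis
      proof eventually_elim
        case (elim s)
        have "C\<^sup>2 < (norm (F s))\<^sup>2" if "s \<in> E n"
          using that C(1) by (intro power_strict_mono) (auto simp: E_def)
        then show ?case using elim by (auto simp: indicator_def)
      qed
    qed
    then have "AE s in lborel. \<forall>n. s \<notin> E n" by (simp add: AE_all_countable)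
    then have F_le: "AE s in lborel. norm (F s) \<le> C"
    proof eventually_elim
      case (elim s)
      obtain n :: nat where n: "max (norm s) (norm (F s)) \<le> real n" using real_arch_simple by blast
      then have "s \<in> cball 0 (real n)" "norm (F s) \<le> real n" by auto
      then show ?case using elim[rule_format, of n] by (auto simp: E_def)
    qed
    have "integrable lborel (\<lambda>s. (norm (F s - rep_L2Linf (f 0) s))\<^sup>2)"
    proof (rule integrableI_bounded)
      show "(\<integral>\<^sup>+s. ennreal (norm ((norm (F s - rep_L2Linf (f 0) s))\<^sup>2)) \<partial>lborel) < \<infinity>"
        using lim[of 0] by (simp add: le_less_trans)
    qed measurable
    then have "integrable lborel (\<lambda>s. 2 * (norm (F s - rep_L2Linf (f 0) s))\<^sup>2 + 2 * (norm (rep_L2Linf (f 0) s))\<^sup>2)"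
      by (intro Bochner_Integration.integrable_add integrable_mult_right rep_integrable_sq)
    then have "integrable lborel (\<lambda>s. (norm (F s))\<^sup>2)"
    proof (rule Bochner_Integration.integrable_bound)
      show "AE s in lborel. norm ((norm (F s))\<^sup>2)
          \<le> norm (2 * (norm (F s - rep_L2Linf (f 0) s))\<^sup>2 + 2 * (norm (rep_L2Linf (f 0) s))\<^sup>2)"
      proof (rule AE_I2)
        fix s
        show "norm ((norm (F s))\<^sup>2)
          \<le> norm (2 * (norm (F s - rep_L2Linf (f 0) s))\<^sup>2 + 2 * (norm (rep_L2Linf (f 0) s))\<^sup>2)"
          using norm_sq_add_le[of "F s - rep_L2Linf (f 0) s" "rep_L2Linf (f 0) s"] by simp
      qed
    qed measurable
    with F_le have "F \<in> L2Linf_fun" unfolding L2Linf_fun_iff by auto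
    define g where "g = abs_L2Linf F"
    have g: "AE s in lborel. rep_L2Linf g s = F s"
      unfolding g_def by (rule rep_abs_L2Linf) fact
    have "nsq (T g - h) \<le> 4 * (1 / 8) ^ j" for j
    proof -
      have "nsq (T g - T (f j)) = nsq (g - f j)"
        using nsq_T[of "g - f j"] by (simp add: clinear_diff[OF linear])
      also have "\<dots> \<le> (1 / 8) ^ j"
      proof (rule close)
        show "AE s in lborel. norm (rep_L2Linf (g - f j) s) \<le> norm (F s - rep_L2Linf (f j) s)"
          using g rep_minus[of g "f j"] by eventually_elim simp
      qed
      finally show ?thesis
        using nsq_triangle_le[of "T g" h "T (f j)"] f[of j] zero_le_power[of "1 / 8 :: real" j] by linarith
    qed
    then have "nsq (T g - h) = 0" by (rule zero_of_le_geometric[OF nsq_nonneg])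
    then have "T g = h" using nsq_eq_0 by fastforce
    then show ?thesis by blast
  qed
  then show ?thesis by (metis surjI)
qed

end

theorem theorem3:
  fixes c :: real
    and \<phi> :: "'d::finite rswn_free \<Rightarrow> complex"
    and \<iota> :: "'d rswn_free \<Rightarrow> 'h::complex_hilbert"
    and T :: "'d L2Linf \<Rightarrow> 'd L2Linf"
  assumes "c > 0"
    and "fock_state c \<phi>"
    and "gns_space \<phi> \<iota>"
    and "clinear T"
  shows "(second_quantization_isometry \<iota> T \<longleftrightarrow>
      (\<exists>(\<alpha> :: real ^ 'd \<Rightarrow> real) T\<^sub>1. star_endomorphism T\<^sub>1 \<and> (\<forall>f. is_phase_mult \<alpha> (T\<^sub>1 f) (T f)))) \<and>
    (second_quantization_unitary \<iota> T \<longleftrightarrow>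
      (\<exists>(\<alpha> :: real ^ 'd \<Rightarrow> real) T\<^sub>1. star_automorphism T\<^sub>1 \<and> (\<forall>f. is_phase_mult \<alpha> (T\<^sub>1 f) (T f))))"
    (is "(?iso \<longleftrightarrow> ?endo) \<and> (?uni \<longleftrightarrow> ?auto)")
proof -
  interpret fock_rep c \<phi> \<iota> using assms by unfold_locales
  have preserving: "moment_preserving T" if ?iso
    by (intro moment_preserving.intro assms(4) isometry_imp_moment[OF assms(4) that])
  have realize: "\<exists>V. hilbert_isometry V \<and> (\<forall>f n. V (\<iota> (create f ^ n)) = \<iota> (create (T f) ^ n)) \<and>
      is_second_quantization \<iota> T V"
    if endo: "star_endomorphism T\<^sub>1" "\<And>f. is_phase_mult \<alpha> (T\<^sub>1 f) (T f)" for \<alpha> T\<^sub>1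
  proof -
    obtain V where "hilbert_isometry V" "\<And>f n. V (\<iota> (create f ^ n)) = \<iota> (create (T f) ^ n)"
      using moment_imp_isometry[OF assms(4) moment_phase[OF endo]] by blast
    then show ?thesis using isometry_is_second_quantization by blast
  qed
  have "?endo" if ?iso
  proof -
    interpret moment_preserving T by (rule preserving[OF that])
    show ?thesis using star_endomorphism_untwisted is_phase_mult_untwisted by blast
  qed
  moreover have "?iso" if ?endo
    using that realize unfolding second_quantization_isometry_def by metis
  moreover have "?auto" if uni: ?uni
  proof -
    obtain G V where V: "is_second_quantization \<iota> T G" "hilbert_unitary V" "\<And>x. x \<in> exp_span \<iota> \<Longrightarrow> V x = G x"
      using uni unfolding second_quantization_unitary_def by blast
    then have iso: "hilbert_isometry V" and "surj V" by (simp_all add: hilbert_unitary_def)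
    then have ?iso using V unfolding second_quantization_isometry_def by blast
    then interpret moment_preserving T by (rule preserving)
    have "\<exists>f. nsq (T f - h) < \<epsilon>" if "\<epsilon> > 0" for h \<epsilon>
      using surj_imp_dense[OF assms(4) iso second_quantization_power[OF assms(4) V(1) iso V(3)] \<open>surj V\<close> that, of h]
      by (simp add: inner_fun_nsq)
    then have "surj T" by (rule dense_imp_surj)
    \<comment> \<open>\<open>surj_phase\<close> is used with the two operators exchanged, hence the
      change of sign of the phase.\<close>
    then have "surj untwisted"
      by (rule surj_phase[OF is_phase_mult_uminus[OF is_phase_mult_untwisted]])
    then show ?thesis
      using star_endomorphism_untwisted is_phase_mult_untwisted unfolding star_automorphism_def by blast
  qed
  moreover have "?uni" if auto: ?auto
  proof -
    obtain \<alpha> T\<^sub>1 where T1: "star_endomorphism T\<^sub>1" "surj T\<^sub>1" "\<And>f. is_phase_mult \<alpha> (T\<^sub>1 f) (T f)"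
      using auto unfolding star_automorphism_def by blast
    obtain V where V: "hilbert_isometry V" "\<And>f n. V (\<iota> (create f ^ n)) = \<iota> (create (T f) ^ n)"
      "is_second_quantization \<iota> T V" using realize[OF T1(1,3)] by blast
    have "surj V" by (rule isometry_surj[OF V(1,2) surj_phase[OF T1(3,2)]])
    then show ?thesis
      using V unfolding second_quantization_unitary_def hilbert_unitary_def by blast
  qed
  ultimately show ?thesis by blast
qed

end
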